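(* Let $D$ be an integrally closed domain which is not a field, with quotient field $K$. Let $A$ be a non-zero $D$-algebra which is torsion-free and finitely generated as a $D$-module, and let $S$ be a non-empty finite subset of $A$. Then the integral closure of $\mathrm{Int}_K(S,A)$ (in its quotient field $K(X)$) is a Prüfer domain if and only if $D$ is a Prüfer domain.
   Context: The algebra $A$ is associative with unit, possibly non-commutative and possibly with zero-divisors. Polynomials of $K[X]$ are evaluated at elements of $A$ inside the extended $K$-algebra $B=A\otimes_D K$, into which $A$ and $K$ embed. Define $\mathrm{Int}_K(S,A)=\{f\in K[X] : f(s)\in A\text{ for all }s\in S\}$. *)

theory Defs
  imports
    "HOL-Algebra.QuotRing"
    "HOL-Algebra.Generated_Groups"
    "HOL-Library.Poly_Mapping"
    "HOL-Computational_Algebra.Polynomial_Factorial"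
begin

text \<open>
  Subrings of a field are sets, so that integral closure and invertibility are taken inside the
  ambient field. A domain \<open>'d\<close> has quotient field \<open>'d fract\<close>, in which it is the subring
  \<open>range to_fract\<close>.
\<close>

definition is_subring :: "'f::field set \<Rightarrow> bool" where
  "is_subring R \<longleftrightarrow> 0 \<in> R \<and> 1 \<in> R \<and> (\<forall>x\<in>R. - x \<in> R) \<and>
     (\<forall>x\<in>R. \<forall>y\<in>R. x + y \<in> R \<and> x * y \<in> R)"

definition integral_over :: "'f::field set \<Rightarrow> 'f \<Rightarrow> bool" where
  "integral_over R x \<longleftrightarrow> (\<exists>p. lead_coeff p = 1 \<and> (\<forall>i. coeff p i \<in> R) \<and> poly p x = 0)"

definition integral_closure :: "'f::field set \<Rightarrow> 'f set" where
  "integral_closure R = {x. integral_over R x}"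

definition integrally_closed_domain :: "'d::idom itself \<Rightarrow> bool" where
  "integrally_closed_domain _ \<longleftrightarrow>
     integral_closure (range (to_fract :: 'd \<Rightarrow> 'd fract)) = range to_fract"

definition is_submodule :: "'f::field set \<Rightarrow> 'f set \<Rightarrow> bool" where
  "is_submodule R J \<longleftrightarrow> 0 \<in> J \<and> (\<forall>x\<in>J. \<forall>y\<in>J. x + y \<in> J) \<and> (\<forall>r\<in>R. \<forall>x\<in>J. r * x \<in> J)"

text \<open>The \<open>R\<close>-module generated by a finite set \<open>G\<close>.\<close>

definition submodule_generated :: "'f::field set \<Rightarrow> 'f set \<Rightarrow> 'f set" where
  "submodule_generated R G = {\<Sum>g\<in>G. c g * g | c. \<forall>g\<in>G. c g \<in> R}"

definition fractional_ideal :: "'f::field set \<Rightarrow> 'f set \<Rightarrow> bool" where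
  "fractional_ideal R J \<longleftrightarrow> is_submodule R J \<and> (\<exists>d\<in>R. d \<noteq> 0 \<and> (\<forall>x\<in>J. d * x \<in> R))"

definition ideal_product :: "'f::field set \<Rightarrow> 'f set \<Rightarrow> 'f set" where
  "ideal_product I J = {\<Sum>k<n. a k * b k | (n::nat) a b. \<forall>k<n. a k \<in> I \<and> b k \<in> J}"

text \<open>
  The inverse \<open>J\<close> is sought in the ambient field rather than in the quotient field of \<open>R\<close>. This
  makes no difference: \<open>d * J \<subseteq> R\<close> with \<open>0 \<noteq> d \<in> R\<close> puts \<open>J\<close> inside the quotient field of \<open>R\<close>.
\<close>

definition invertible_ideal :: "'f::field set \<Rightarrow> 'f set \<Rightarrow> bool" where
  "invertible_ideal R I \<longleftrightarrow> (\<exists>J. fractional_ideal R J \<and> ideal_product I J = R)"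

definition prufer_domain :: "'f::field set \<Rightarrow> bool" where
  "prufer_domain R \<longleftrightarrow> is_subring R \<and>
     (\<forall>G. finite G \<and> G \<subseteq> R \<and> submodule_generated R G \<noteq> {0} \<longrightarrow>
        invertible_ideal R (submodule_generated R G))"

text \<open>
  An associative unital algebra over a commutative ring \<open>'d\<close>; the class \<^class>\<open>ring_1\<close> includes
  \<open>0 \<noteq> 1\<close>, so such an algebra is non-zero.
\<close>

locale unital_algebra = module scale
  for scale :: "'d::comm_ring_1 \<Rightarrow> 'a::ring_1 \<Rightarrow> 'a" +
  assumes scale_mult_left: "scale d (a * b) = scale d a * b"
    and scale_mult_right: "scale d (a * b) = a * scale d b"

definition torsion_free_module :: "('d::idom \<Rightarrow> 'a::ab_group_add \<Rightarrow> 'a) \<Rightarrow> bool" where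
  "torsion_free_module scale \<longleftrightarrow> (\<forall>d a. scale d a = 0 \<longrightarrow> d = 0 \<or> a = 0)"

definition finitely_generated_module :: "('d::comm_ring_1 \<Rightarrow> 'a::ab_group_add \<Rightarrow> 'a) \<Rightarrow> bool" where
  "finitely_generated_module scale \<longleftrightarrow> (\<exists>G. finite G \<and> module.span scale G = UNIV)"

text \<open>
  The tensor product of two \<open>'d\<close>-algebras is the free abelian group on pairs \<open>(a, b)\<close>, with
  \<open>(a, b) (a', b') = (a a', b b')\<close> extended bilinearly, modulo the subgroup generated by the
  bilinearity and balancing relators. This subgroup is a two-sided ideal, because the product of
  a relator with a pair is again a relator.
\<close>

definition free_pair_ring :: "(('a::ring_1 \<times> 'b::ring_1) \<Rightarrow>\<^sub>0 int) ring" where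
  "free_pair_ring =
     \<lparr>carrier = UNIV,
      monoid.mult = (\<lambda>u v. frag_extend (\<lambda>(a, b). frag_extend (\<lambda>(a', b'). frag_of (a * a', b * b')) v) u),
      one = frag_of (1, 1), zero = 0, add = (+)\<rparr>"

definition tensor_relators ::
  "('d \<Rightarrow> 'a \<Rightarrow> 'a) \<Rightarrow> ('d \<Rightarrow> 'b \<Rightarrow> 'b) \<Rightarrow> (('a::ring_1 \<times> 'b::ring_1) \<Rightarrow>\<^sub>0 int) set" where
  "tensor_relators sA sB =
     {frag_of (a + a', b) - frag_of (a, b) - frag_of (a', b) | a a' b. True} \<union>
     {frag_of (a, b + b') - frag_of (a, b) - frag_of (a, b') | a b b'. True} \<union>
     {frag_of (sA d a, b) - frag_of (a, sB d b) | d a b. True}"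

definition tensor_kernel ::
  "('d \<Rightarrow> 'a \<Rightarrow> 'a) \<Rightarrow> ('d \<Rightarrow> 'b \<Rightarrow> 'b) \<Rightarrow> (('a::ring_1 \<times> 'b::ring_1) \<Rightarrow>\<^sub>0 int) set" where
  "tensor_kernel sA sB = generate (add_monoid free_pair_ring) (tensor_relators sA sB)"

definition tensor_ring ::
  "('d \<Rightarrow> 'a \<Rightarrow> 'a) \<Rightarrow> ('d \<Rightarrow> 'b \<Rightarrow> 'b) \<Rightarrow> (('a::ring_1 \<times> 'b::ring_1) \<Rightarrow>\<^sub>0 int) set ring" where
  "tensor_ring sA sB = free_pair_ring Quot tensor_kernel sA sB"

definition pure_tensor ::
  "('d \<Rightarrow> 'a \<Rightarrow> 'a) \<Rightarrow> ('d \<Rightarrow> 'b \<Rightarrow> 'b) \<Rightarrow> 'a \<Rightarrow> 'b \<Rightarrow> (('a::ring_1 \<times> 'b::ring_1) \<Rightarrow>\<^sub>0 int) set" where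
  "pure_tensor sA sB a b = tensor_kernel sA sB +>\<^bsub>free_pair_ring\<^esub> frag_of (a, b)"

definition fract_scale :: "'d::idom \<Rightarrow> 'd fract \<Rightarrow> 'd fract" where
  "fract_scale d x = to_fract d * x"

text \<open>
  \<open>B = A \<otimes>\<^sub>D K\<close> with the canonical maps of \<open>A\<close> and \<open>K\<close>; for torsion-free \<open>A\<close> the map
  \<open>a \<mapsto> a \<otimes> 1\<close> is injective, so its range is the copy of \<open>A\<close> in \<open>B\<close>.
\<close>

definition extended_algebra ::
  "('d::idom \<Rightarrow> 'a \<Rightarrow> 'a) \<Rightarrow> (('a::ring_1 \<times> 'd fract) \<Rightarrow>\<^sub>0 int) set ring" where
  "extended_algebra scale = tensor_ring scale fract_scale"

definition embed_alg ::
  "('d::idom \<Rightarrow> 'a \<Rightarrow> 'a) \<Rightarrow> 'a \<Rightarrow> (('a::ring_1 \<times> 'd fract) \<Rightarrow>\<^sub>0 int) set" where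
  "embed_alg scale a = pure_tensor scale fract_scale a 1"

definition embed_field ::
  "('d::idom \<Rightarrow> 'a \<Rightarrow> 'a) \<Rightarrow> 'd fract \<Rightarrow> (('a::ring_1 \<times> 'd fract) \<Rightarrow>\<^sub>0 int) set" where
  "embed_field scale x = pure_tensor scale fract_scale 1 x"

definition eval_extended ::
  "('d::idom \<Rightarrow> 'a \<Rightarrow> 'a) \<Rightarrow> 'd fract poly \<Rightarrow> (('a::ring_1 \<times> 'd fract) \<Rightarrow>\<^sub>0 int) set
    \<Rightarrow> (('a \<times> 'd fract) \<Rightarrow>\<^sub>0 int) set" where
  "eval_extended scale f s =
     (\<Oplus>\<^bsub>extended_algebra scale\<^esub> i \<in> {..degree f}.
        embed_field scale (coeff f i) \<otimes>\<^bsub>extended_algebra scale\<^esub>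
        (s [^]\<^bsub>extended_algebra scale\<^esub> i))"

definition Int_K :: "('d::idom \<Rightarrow> 'a::ring_1 \<Rightarrow> 'a) \<Rightarrow> 'a set \<Rightarrow> 'd fract poly set" where
  "Int_K scale S =
     {f. \<forall>s\<in>S. eval_extended scale f (embed_alg scale s) \<in> range (embed_alg scale)}"

end

theory Submission
  imports Defs "HOL-Algebra.Algebraic_Closure_Type" "Jordan_Normal_Form.Char_Poly"
begin

text \<open>
  Why the theorem holds. Let \<open>\<mu>\<close> generate the ideal of all \<open>f \<in> K[X]\<close> that vanish at every
  element of \<open>S\<close>, let \<open>Z\<close> be the finite non-empty set of roots of \<open>\<mu>\<close> in an algebraic closure of
  \<open>K\<close>, let \<open>O\<close> be the integral closure of \<open>D\<close> in that field, and let
  \<open>C = {f \<in> K[X]. f(\<alpha>) \<in> O for all \<alpha> \<in> Z}\<close>. The integral closure of \<open>Int_K(S,A)\<close> is \<open>C\<close>: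
  elements of the finite \<open>D\<close>-algebra \<open>A\<close> are integral, so for \<open>f \<in> Int_K(S,A)\<close> some monic \<open>p\<close> over
  \<open>D\<close> kills all the values \<open>f(s)\<close>; then \<open>\<mu>\<close> divides \<open>p(f)\<close> and \<open>f \<in> C\<close>. Conversely \<open>f \<in> C\<close> gives
  a monic \<open>p\<close> over \<open>D\<close> with \<open>p(f) \<in> \<mu> K[X] \<subseteq> Int_K(S,A)\<close>. Nothing outside \<open>K[X]\<close> is integral
  because \<open>K[X]\<close> is integrally closed (\<open>vanishing_polynomial\<close>, \<open>int_valued_roots_integral\<close>,
  \<open>integral_closure_eq_integral_on\<close>). The algebra has disappeared from the problem.

  A domain \<open>R\<close> is Pruefer iff for every quotient \<open>x\<close> of non-zero elements there is \<open>u \<in> R\<close> with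
  \<open>u x \<in> R\<close> and \<open>(1 - u) / x \<in> R\<close> (\<open>prufer_domain_iff_pairs\<close>); this is the elementwise form of
  "locally \<open>x\<close> or \<open>1/x\<close> belongs to \<open>R\<close>", and both directions are proved with it.

  From \<open>C\<close> to \<open>D\<close> (\<open>prufer_base_domain\<close>). For \<open>x = a/b\<close> with \<open>a, b \<in> D\<close> the criterion in \<open>C\<close> gives
  \<open>f\<close> such that \<open>f\<close>, \<open>x f\<close> and \<open>(1 - f)/x\<close> are all in \<open>C\<close>. Evaluate at one \<open>\<alpha> \<in> Z\<close> and let
  \<open>m = X^N + m_(N-1) X^(N-1) + ... + m_0\<close> be the minimal polynomial of \<open>u = f(\<alpha>)\<close> over \<open>K\<close>. All
  conjugates of \<open>u\<close>, \<open>x u\<close> and \<open>(1 - u)/x\<close> are integral and \<open>D\<close> is integrally closed, so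
  \<open>m_i\<close>, \<open>m_i x^(N-i)\<close>, \<open>m(1)\<close> and \<open>m(1)/x^N\<close> lie in \<open>D\<close>, and then so do \<open>m_i x\<close> for \<open>i < N\<close> and
  \<open>m(1)/x\<close>. As \<open>1 = m(1) - (m_0 + ... + m_(N-1))\<close>, the element \<open>1 - m(1)\<close> is as required.

  From \<open>D\<close> to \<open>C\<close> (\<open>prufer_integral_on\<close>). Write \<open>x = F/G\<close> with \<open>w F + v G = 1\<close>. All other Bezout
  pairs are \<open>v + t F\<close>, \<open>w - t G\<close>, and \<open>t\<close> has to be chosen so that \<open>(v + t F) G\<close>,
  \<open>(v + t F) F\<close> and \<open>(w - t G) G\<close> take integral values on \<open>Z\<close>. At a single
  \<open>\<alpha>\<close> where \<open>F\<close> and \<open>G\<close> do not vanish this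
  amounts to the criterion for \<open>y = F(\<alpha>)/G(\<alpha>)\<close> in \<open>O\<close>, with a solution in \<open>K[y]\<close>; such a solution is read off from
  an algebraic equation of \<open>y\<close> over \<open>D\<close>, whose content is an invertible ideal
  (\<open>prufer_pair_in_alg_ints\<close>). Solutions at the points of \<open>Z\<close> are glued by interpolation
  over \<open>K\<close> (\<open>ac_eval_interpolation\<close>).

  The tensor product enters only through \<open>eval_extended_eq_embed_iff\<close>: \<open>f(s) = a\<close> holds in
  \<open>A \<otimes>\<^sub>D K\<close> iff \<open>(d f)(s) = d a\<close> holds in \<open>A\<close> after clearing denominators.
\<close>

hide_const (open) Polynomials.degree Polynomials.lead_coeff up_ring.coeff up_ring.monom
  Module.module module.smult

section \<open>Subrings and integral closure\<close>

lemma is_subringD: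
  assumes "is_subring R"
  shows "0 \<in> R" "1 \<in> R" "x \<in> R \<Longrightarrow> - x \<in> R" "x \<in> R \<Longrightarrow> y \<in> R \<Longrightarrow> x + y \<in> R"
    "x \<in> R \<Longrightarrow> y \<in> R \<Longrightarrow> x * y \<in> R" "x \<in> R \<Longrightarrow> y \<in> R \<Longrightarrow> x - y \<in> R"
proof -
  show "x \<in> R \<Longrightarrow> y \<in> R \<Longrightarrow> x - y \<in> R"
    using assms unfolding is_subring_def by (metis add_uminus_conv_diff)
qed (use assms in \<open>auto simp: is_subring_def\<close>)

lemma is_subring_sum:
  assumes "is_subring R" "\<And>i. i \<in> I \<Longrightarrow> f i \<in> R"
  shows "sum f I \<in> R"
  using assms(2) by (induction I rule: infinite_finite_induct) (auto intro: is_subringD[OF assms(1)])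

lemma is_subring_power:
  assumes "is_subring R" "x \<in> R"
  shows "x ^ n \<in> R"
  using assms(2) by (induction n) (auto intro: is_subringD[OF assms(1)])

lemma is_subring_coeff_mult:
  assumes "is_subring R" "\<forall>i. coeff p i \<in> R" "\<forall>i. coeff q i \<in> R"
  shows "\<forall>i. coeff (p * q) i \<in> R"
  using assms(2,3) by (auto simp: coeff_mult intro!: is_subring_sum[OF assms(1)] is_subringD[OF assms(1)])

lemma is_subring_coeff_det:
  assumes R: "is_subring R" and N: "N \<in> carrier_mat n n"
    and "\<And>i j k. i < n \<Longrightarrow> j < n \<Longrightarrow> coeff (N $$ (i, j)) k \<in> R"
  shows "coeff (det N) k \<in> R"
proof -
  have prod: "\<forall>k. coeff (prod f I) k \<in> R"
    if "finite I" "\<And>i. i \<in> I \<Longrightarrow> \<forall>k. coeff (f i) k \<in> R" for f :: "nat \<Rightarrow> 'a poly" and I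
    using that
  proof (induction I rule: finite_induct)
    case empty
    then show ?case by (auto simp: coeff_1 intro: is_subringD[OF R])
  next
    case (insert x F)
    then show ?case using is_subring_coeff_mult[OF R] by simp
  qed
  have "\<forall>k. coeff (signof p * (\<Prod>i = 0..<n. N $$ (i, p i))) k \<in> R"
    if "p permutes {0..<n}" for p
  proof -
    have "\<forall>k. coeff (\<Prod>i = 0..<n. N $$ (i, p i)) k \<in> R"
      using assms(3) permutes_in_image[OF that] by (intro prod) auto
    then show ?thesis
      by (cases rule: sign_cases[of p]) (auto intro: is_subringD[OF R])
  qed
  then show ?thesis
    unfolding det_def'[OF N] by (auto simp: coeff_sum intro!: is_subring_sum[OF R])
qed

text \<open>
  Cramer's rule: multiply the system by the adjugate matrix. The scalars are kept abstract because
  the lemma serves twice: once with polynomials over a field acting through their value at \<open>x\<close>,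
  once with polynomials over \<open>D\<close> acting on a non-commutative algebra.
\<close>

lemma det_annihilates:
  fixes act :: "'r::comm_ring_1 \<Rightarrow> 'b::ab_group_add \<Rightarrow> 'b"
  assumes "Modules.module act" and N: "N \<in> carrier_mat n n"
    and ker: "\<And>j. j < n \<Longrightarrow> (\<Sum>k<n. act (N $$ (j, k)) (v k)) = 0" and i: "i < n"
  shows "act (det N) (v i) = 0"
proof -
  interpret Modules.module act by fact
  note adj = adj_mat(1,3)[OF N]
  have *: "(\<Sum>j<n. adj_mat N $$ (i, j) * N $$ (j, k)) = (if k = i then det N else 0)" if "k < n" for k
  proof -
    have "(\<Sum>j<n. adj_mat N $$ (i, j) * N $$ (j, k)) = (adj_mat N * N) $$ (i, k)"
      using adj(1) N i that by (auto simp: scalar_prod_def atLeast0LessThan)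
    then show ?thesis unfolding adj(2) using i that by auto
  qed
  have "0 = (\<Sum>j<n. act (adj_mat N $$ (i, j)) (\<Sum>k<n. act (N $$ (j, k)) (v k)))"
    using ker by simp
  also have "\<dots> = (\<Sum>k<n. \<Sum>j<n. act (adj_mat N $$ (i, j) * N $$ (j, k)) (v k))"
    by (subst sum.swap) (simp add: scale_sum_right)
  also have "\<dots> = (\<Sum>k<n. act (\<Sum>j<n. adj_mat N $$ (i, j) * N $$ (j, k)) (v k))"
    by (simp add: scale_sum_left)
  also have "\<dots> = (\<Sum>k<n. if k = i then act (det N) (v i) else 0)"
    by (intro sum.cong) (auto simp: *)
  also have "\<dots> = act (det N) (v i)" using i by simp
  finally show ?thesis by simp
qed

lemma integral_over_iff:
  assumes R: "is_subring R"
  shows "integral_over R x \<longleftrightarrow> (\<exists>n c. (\<forall>i<n. c i \<in> R) \<and> x ^ n + (\<Sum>i<n. c i * x ^ i) = 0)"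
proof
  assume "integral_over R x"
  then obtain p where p: "lead_coeff p = 1" "\<forall>i. coeff p i \<in> R" "poly p x = 0"
    unfolding integral_over_def by auto
  have "poly p x = (\<Sum>i<degree p. coeff p i * x ^ i) + x ^ degree p"
    using p(1) by (simp add: poly_altdef lessThan_Suc_atMost[symmetric])
  then show "\<exists>n c. (\<forall>i<n. c i \<in> R) \<and> x ^ n + (\<Sum>i<n. c i * x ^ i) = 0"
    using p by (intro exI[of _ "degree p"] exI[of _ "coeff p"]) (auto simp: add.commute)
next
  assume "\<exists>n c. (\<forall>i<n. c i \<in> R) \<and> x ^ n + (\<Sum>i<n. c i * x ^ i) = 0"
  then obtain n c where c: "\<forall>i<n. c i \<in> R" "x ^ n + (\<Sum>i<n. c i * x ^ i) = 0" by auto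
  define p where "p = monom 1 n + (\<Sum>i<n. monom (c i) i)"
  have co: "coeff p j = (if j = n then 1 else if j < n then c j else 0)" for j
    by (auto simp: p_def coeff_sum)
  have "degree p = n"
    by (intro antisym degree_le le_degree) (auto simp: co)
  then have "lead_coeff p = 1" by (simp add: co)
  moreover have "poly p x = 0" using c(2) by (simp add: p_def poly_monom poly_sum)
  ultimately show "integral_over R x"
    unfolding integral_over_def using c(1) is_subringD(1,2)[OF R] by (intro exI[of _ p]) (auto simp: co)
qed

context
  fixes R :: "'f::field set"
  assumes R: "is_subring R"
begin

lemma gen_add:
  assumes "x \<in> submodule_generated R G" "y \<in> submodule_generated R G"
  shows "x + y \<in> submodule_generated R G"
proof -
  obtain c d where "x = (\<Sum>g\<in>G. c g * g)" "\<forall>g\<in>G. c g \<in> R" "y = (\<Sum>g\<in>G. d g * g)" "\<forall>g\<in>G. d g \<in> R"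
    using assms unfolding submodule_generated_def by auto
  then show ?thesis unfolding submodule_generated_def
    by (auto simp: sum.distrib algebra_simps intro!: exI[of _ "\<lambda>g. c g + d g"] is_subringD[OF R])
qed

lemma gen_scale:
  assumes "r \<in> R" "x \<in> submodule_generated R G"
  shows "r * x \<in> submodule_generated R G"
proof -
  obtain c where "x = (\<Sum>g\<in>G. c g * g)" "\<forall>g\<in>G. c g \<in> R"
    using assms unfolding submodule_generated_def by auto
  then show ?thesis unfolding submodule_generated_def using assms(1)
    by (auto simp: sum_distrib_left algebra_simps intro!: exI[of _ "\<lambda>g. r * c g"] is_subringD[OF R])
qed

lemma gen_zero: "0 \<in> submodule_generated R G"
  unfolding submodule_generated_def using is_subringD(1)[OF R] by (auto intro!: exI[of _ "\<lambda>_. 0"])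

lemma gen_base:
  assumes "finite G" "g \<in> G"
  shows "g \<in> submodule_generated R G"
proof -
  have "g = (\<Sum>h\<in>G. (if h = g then 1 else 0) * h)"
    using assms by (simp add: if_distrib[of "\<lambda>c. c * _"] cong: if_cong)
  then show ?thesis unfolding submodule_generated_def
    using is_subringD(1,2)[OF R] by (auto intro!: exI[of _ "\<lambda>h. if h = g then 1 else 0"])
qed

lemma gen_sum:
  assumes "\<And>i. i \<in> I \<Longrightarrow> f i \<in> submodule_generated R G"
  shows "sum f I \<in> submodule_generated R G"
  using assms by (induction I rule: infinite_finite_induct) (auto intro: gen_zero gen_add)

lemma gen_times:
  assumes "\<And>g. g \<in> G \<Longrightarrow> z * g \<in> submodule_generated R H" "m \<in> submodule_generated R G"
  shows "z * m \<in> submodule_generated R H"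
proof -
  obtain c where c: "m = (\<Sum>g\<in>G. c g * g)" "\<forall>g\<in>G. c g \<in> R"
    using assms unfolding submodule_generated_def by auto
  have "z * m = (\<Sum>g\<in>G. c g * (z * g))" by (simp add: c sum_distrib_left algebra_simps)
  also have "\<dots> \<in> submodule_generated R H"
    by (rule gen_sum, rule gen_scale) (use c assms(1) in auto)
  finally show ?thesis .
qed

text \<open>
  The determinant trick: \<open>x\<close> acts on the generators by a matrix over \<open>R\<close>, and its characteristic
  polynomial vanishes at \<open>x\<close> because it kills a non-zero element of the field.
\<close>

lemma integral_over_if_stable:
  assumes fin: "finite G" and nz: "g \<in> G" "g \<noteq> 0"
    and stable: "\<And>h. h \<in> G \<Longrightarrow> x * h \<in> submodule_generated R G"
  shows "integral_over R x"
proof -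
  define n where "n = card G"
  obtain v where v: "bij_betw v {..<n} G"
    using ex_bij_betw_nat_finite[OF fin] by (auto simp: atLeast0LessThan n_def)
  have "\<forall>h\<in>G. \<exists>c. x * h = (\<Sum>g\<in>G. c g * g) \<and> (\<forall>g\<in>G. c g \<in> R)"
    using stable unfolding submodule_generated_def by auto
  then obtain c where c: "\<And>h. h \<in> G \<Longrightarrow> x * h = (\<Sum>g\<in>G. c h g * g)"
      "\<And>h g. h \<in> G \<Longrightarrow> g \<in> G \<Longrightarrow> c h g \<in> R"
    by metis
  have vG: "v j \<in> G" if "j < n" for j using v that by (auto simp: bij_betw_def)
  define M where "M = mat n n (\<lambda>(j, k). c (v j) (v k))"
  have M: "M \<in> carrier_mat n n" by (simp add: M_def)
  define N where "N = char_poly_matrix M"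
  have N: "N \<in> carrier_mat n n" using M by (simp add: N_def)
  have entry: "N $$ (j, k) = (if j = k then [:0, 1:] else 0) + [:- c (v j) (v k):]"
    if "j < n" "k < n" for j k
    using that by (simp add: N_def char_poly_matrix_def M_def)
  have module: "Modules.module (\<lambda>p y. poly p x * y)"
    by unfold_locales (auto simp: algebra_simps)
  have xv: "x * v j = (\<Sum>k<n. c (v j) (v k) * v k)" if "j < n" for j
    using c(1)[OF vG[OF that]] sum.reindex_bij_betw[OF v, of "\<lambda>g. c (v j) g * g"] by simp
  have ker: "(\<Sum>k<n. poly (N $$ (j, k)) x * v k) = 0" if "j < n" for j
  proof -
    have "(\<Sum>k<n. poly (N $$ (j, k)) x * v k) = (\<Sum>k<n. (if k = j then x * v j else 0) - c (v j) (v k) * v k)"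
      using that by (intro sum.cong) (auto simp: entry algebra_simps)
    also have "\<dots> = 0" using that xv by (simp add: sum_subtractf)
    finally show ?thesis .
  qed
  obtain i where i: "i < n" "v i = g" using v nz(1) by (auto simp: bij_betw_def)
  have "poly (char_poly M) x * v i = 0"
    using det_annihilates[OF module N ker i(1)] by (simp add: char_poly_def N_def)
  then have "poly (char_poly M) x = 0" using nz i by simp
  moreover have "coeff (char_poly M) k \<in> R" for k
    unfolding char_poly_def N_def[symmetric] using is_subringD[OF R] c(2) vG
    by (intro is_subring_coeff_det[OF R N]) (auto simp: entry coeff_pCons split: nat.splits)
  moreover have "lead_coeff (char_poly M) = 1" using degree_monic_char_poly[OF M] by auto
  ultimately show ?thesis unfolding integral_over_def by blast
qed

text \<open>
  The coefficients \<open>c i\<close> need not lie in \<open>R\<close>, they only have to stabilise the module. Because of this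
  generality the lemma yields closure under sums and products as well as transitivity.
\<close>

lemma adjoin_integral_element:
  assumes fin: "finite G" and one: "1 \<in> submodule_generated R G"
    and c: "\<And>i g. i < n \<Longrightarrow> g \<in> G \<Longrightarrow> c i * g \<in> submodule_generated R G"
    and y: "y ^ n + (\<Sum>i<n. c i * y ^ i) = 0"
  shows "\<exists>G'. finite G' \<and> 1 \<in> submodule_generated R G' \<and>
    (\<forall>z. (\<forall>g\<in>G. z * g \<in> submodule_generated R G) \<longrightarrow> (\<forall>g\<in>G'. z * g \<in> submodule_generated R G')) \<and>
    (\<forall>g\<in>G'. y * g \<in> submodule_generated R G')"
proof -
  \<comment> \<open>The new module is \<open>M + y M + ... + y^(n-1) M\<close>.\<close>
  define G' where "G' = (\<lambda>(i, g). y ^ i * g) ` ({..<n} \<times> G)"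
  have fin': "finite G'" using fin by (simp add: G'_def)
  have pow: "y ^ i * m \<in> submodule_generated R G'" if "i < n" "m \<in> submodule_generated R G" for i m
    using that by (intro gen_times[OF _ that(2)] gen_base[OF fin']) (auto simp: G'_def)
  have "n \<noteq> 0" using y by (intro notI) simp
  then have one': "1 \<in> submodule_generated R G'" using pow[OF _ one, of 0] by simp
  have stab: "z * h \<in> submodule_generated R G'"
    if "\<And>g. g \<in> G \<Longrightarrow> z * g \<in> submodule_generated R G" "h \<in> G'" for z h
  proof -
    obtain i g where "h = y ^ i * g" "i < n" "g \<in> G" using \<open>h \<in> G'\<close> by (auto simp: G'_def)
    then show ?thesis using pow[of i "z * g"] that(1) by (simp add: algebra_simps)
  qed
  have ystab: "y * h \<in> submodule_generated R G'" if "h \<in> G'" for h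
  proof -
    obtain i g where h: "h = y ^ i * g" "i < n" "g \<in> G" using \<open>h \<in> G'\<close> by (auto simp: G'_def)
    show ?thesis
    proof (cases "Suc i < n")
      case True
      then show ?thesis using pow[OF True gen_base[OF fin h(3)]] h(1) by (simp add: algebra_simps)
    next
      case False
      then have "Suc i = n" using h(2) by simp
      then have "y * h = y ^ n * g" using h(1) by (auto simp: algebra_simps)
      also have "y ^ n = - (\<Sum>j<n. c j * y ^ j)" using y by (simp add: eq_neg_iff_add_eq_0)
      also have "\<dots> * g = (\<Sum>j<n. (- 1) * (y ^ j * (c j * g)))"
        by (simp add: sum_distrib_left sum_negf algebra_simps)
      also have "\<dots> \<in> submodule_generated R G'"
        by (rule gen_sum, rule gen_scale, use is_subringD[OF R] in blast, rule pow)
          (use c h(3) in auto)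
      finally show ?thesis .
    qed
  qed
  show ?thesis using fin' one' stab ystab by blast
qed

lemma finite_integral_stable:
  assumes "finite T" "T \<subseteq> integral_closure R"
  obtains G where "finite G" "1 \<in> submodule_generated R G"
    "\<And>z g. z \<in> T \<Longrightarrow> g \<in> G \<Longrightarrow> z * g \<in> submodule_generated R G"
  using assms
proof (induction T arbitrary: thesis rule: finite_induct)
  case empty
  show ?case by (rule empty(1)[of "{1}"]) (auto intro: gen_base)
next
  case (insert y T)
  then obtain G where G: "finite G" "1 \<in> submodule_generated R G"
    "\<And>z g. z \<in> T \<Longrightarrow> g \<in> G \<Longrightarrow> z * g \<in> submodule_generated R G" by auto
  obtain n c where c: "\<forall>i<n. c i \<in> R" "y ^ n + (\<Sum>i<n. c i * y ^ i) = 0"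
    using insert.prems(2) unfolding integral_closure_def integral_over_iff[OF R] by auto
  have "c i * g \<in> submodule_generated R G" if "i < n" "g \<in> G" for i g
    using that c gen_scale gen_base[OF G(1)] by auto
  from adjoin_integral_element[OF G(1,2) this c(2)] obtain G' where
    "finite G'" "1 \<in> submodule_generated R G'"
    "\<forall>z. (\<forall>g\<in>G. z * g \<in> submodule_generated R G) \<longrightarrow> (\<forall>g\<in>G'. z * g \<in> submodule_generated R G')"
    "\<forall>g\<in>G'. y * g \<in> submodule_generated R G'"
    by blast
  then show ?case using G(3) by (intro insert.prems(1)[of G']) auto
qed

lemma integral_over_if_stable_one:
  assumes "finite G" "1 \<in> submodule_generated R G"
    "\<And>h. h \<in> G \<Longrightarrow> x * h \<in> submodule_generated R G"
  shows "integral_over R x"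
proof -
  have "\<exists>g\<in>G. g \<noteq> 0"
  proof (rule ccontr)
    assume "\<not> (\<exists>g\<in>G. g \<noteq> 0)"
    then have "(\<Sum>g\<in>G. c g * g) = 0" for c by (intro sum.neutral) auto
    then show False using assms(2) by (auto simp: submodule_generated_def)
  qed
  then show ?thesis using integral_over_if_stable assms by blast
qed

lemma subset_integral_closure: "R \<subseteq> integral_closure R"
proof
  fix x assume "x \<in> R"
  then show "x \<in> integral_closure R"
    unfolding integral_closure_def integral_over_iff[OF R]
    by (auto intro!: exI[of _ 1] exI[of _ "\<lambda>_. - x"] is_subringD[OF R])
qed

lemma integral_closure_subring: "is_subring (integral_closure R)"
proof -
  have "x + y \<in> integral_closure R \<and> x * y \<in> integral_closure R \<and> - x \<in> integral_closure R"
    if xy: "x \<in> integral_closure R" "y \<in> integral_closure R" for x y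
  proof -
    obtain G where G: "finite G" "1 \<in> submodule_generated R G"
      "\<And>z g. z \<in> {x, y} \<Longrightarrow> g \<in> G \<Longrightarrow> z * g \<in> submodule_generated R G"
      using finite_integral_stable[of "{x, y}"] xy by auto
    have x: "x * g \<in> submodule_generated R G" and y: "y * g \<in> submodule_generated R G" if "g \<in> G" for g
      using G(3) that by auto
    have "integral_over R (x + y)"
      by (rule integral_over_if_stable_one[OF G(1,2)]) (use x y in \<open>auto simp: algebra_simps intro: gen_add\<close>)
    moreover have "integral_over R (x * y)"
      by (rule integral_over_if_stable_one[OF G(1,2)]) (use x y gen_times[of G x G] in \<open>auto simp: mult.assoc\<close>)
    moreover have "integral_over R (- x)"
      by (rule integral_over_if_stable_one[OF G(1,2)])
        (use x gen_scale[of "-1"] is_subringD[OF R] in force)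
    ultimately show ?thesis by (simp add: integral_closure_def)
  qed
  then show ?thesis
    using subset_integral_closure is_subringD(1,2)[OF R] unfolding is_subring_def by blast
qed

lemma integral_closure_idem:
  assumes "integral_over (integral_closure R) y"
  shows "y \<in> integral_closure R"
proof -
  obtain n c where c: "\<forall>i<n. c i \<in> integral_closure R" "y ^ n + (\<Sum>i<n. c i * y ^ i) = 0"
    using assms unfolding integral_over_iff[OF integral_closure_subring] by auto
  obtain G where G: "finite G" "1 \<in> submodule_generated R G"
    "\<And>z g. z \<in> c ` {..<n} \<Longrightarrow> g \<in> G \<Longrightarrow> z * g \<in> submodule_generated R G"
    using finite_integral_stable[of "c ` {..<n}"] c(1) by auto
  have "c i * g \<in> submodule_generated R G" if "i < n" "g \<in> G" for i g using G(3) that by auto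
  from adjoin_integral_element[OF G(1,2) this c(2)] obtain G' where
    "finite G'" "1 \<in> submodule_generated R G'" "\<And>g. g \<in> G' \<Longrightarrow> y * g \<in> submodule_generated R G'"
    by metis
  then have "integral_over R y" by (rule integral_over_if_stable_one)
  then show ?thesis by (simp add: integral_closure_def)
qed

end

section \<open>Invertible ideals as partitions of unity\<close>

text \<open>
  The \<open>e g\<close> are the coefficients that witness \<open>1 \<in> I J\<close>. Conversely the only candidate for the inverse
  is \<open>{y. y I \<subseteq> R}\<close>, and it contains every \<open>e g\<close>.
\<close>

lemma invertible_ideal_iff_partition:
  assumes R: "is_subring R" and fin: "finite G" and sub: "G \<subseteq> R"
  shows "invertible_ideal R (submodule_generated R G) \<longleftrightarrow>
    (\<exists>e. (\<Sum>g\<in>G. e g * g) = 1 \<and> (\<forall>g\<in>G. \<forall>h\<in>G. e g * h \<in> R))"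
proof
  assume "invertible_ideal R (submodule_generated R G)"
  then obtain J where J: "ideal_product (submodule_generated R G) J = R"
    unfolding invertible_ideal_def by auto
  have "1 \<in> ideal_product (submodule_generated R G) J" using J is_subringD[OF R] by auto
  then obtain n :: nat and a b where ab: "1 = (\<Sum>k<n. a k * b k)"
      "\<And>k. k < n \<Longrightarrow> a k \<in> submodule_generated R G" "\<And>k. k < n \<Longrightarrow> b k \<in> J"
    unfolding ideal_product_def by auto
  have "\<forall>k\<in>{..<n}. \<exists>c. a k = (\<Sum>g\<in>G. c g * g) \<and> (\<forall>g\<in>G. c g \<in> R)"
    using ab(2) unfolding submodule_generated_def by auto
  then obtain r where r: "\<And>k. k < n \<Longrightarrow> a k = (\<Sum>g\<in>G. r k g * g)"
      "\<And>k g. k < n \<Longrightarrow> g \<in> G \<Longrightarrow> r k g \<in> R"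
    by (metis lessThan_iff)
  define e where "e g = (\<Sum>k<n. r k g * b k)" for g
  have "(\<Sum>g\<in>G. e g * g) = (\<Sum>k<n. \<Sum>g\<in>G. r k g * b k * g)"
    unfolding e_def sum_distrib_right by (rule sum.swap)
  also have "\<dots> = 1"
    unfolding ab(1) by (intro sum.cong refl) (simp add: r(1) sum_distrib_left sum_distrib_right algebra_simps)
  finally have "(\<Sum>g\<in>G. e g * g) = 1" .
  moreover have "e g * h \<in> R" if gh: "g \<in> G" "h \<in> G" for g h
  proof -
    have hb: "h * b k \<in> R" if "k < n" for k
    proof -
      have "h * b k \<in> ideal_product (submodule_generated R G) J"
        unfolding ideal_product_def using ab(3)[OF that] gen_base[OF R fin gh(2)]
        by (intro CollectI exI[of _ "1::nat"] exI[of _ "\<lambda>_. h"] exI[of _ "\<lambda>_. b k"]) auto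
      then show ?thesis using J by simp
    qed
    have "(\<Sum>k<n. r k g * (h * b k)) \<in> R"
      by (rule is_subring_sum[OF R], rule is_subringD(5)[OF R]) (use r(2) gh hb in auto)
    then show ?thesis by (simp add: e_def sum_distrib_left mult_ac)
  qed
  ultimately show "\<exists>e. (\<Sum>g\<in>G. e g * g) = 1 \<and> (\<forall>g\<in>G. \<forall>h\<in>G. e g * h \<in> R)" by blast
next
  assume "\<exists>e. (\<Sum>g\<in>G. e g * g) = 1 \<and> (\<forall>g\<in>G. \<forall>h\<in>G. e g * h \<in> R)"
  then obtain e where e: "(\<Sum>g\<in>G. e g * g) = 1" "\<And>g h. g \<in> G \<Longrightarrow> h \<in> G \<Longrightarrow> e g * h \<in> R" by blast
  define J where "J = {y. \<forall>a\<in>G. y * a \<in> R}"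
  have "\<exists>g\<in>G. g \<noteq> 0"
  proof (rule ccontr)
    assume "\<not> (\<exists>g\<in>G. g \<noteq> 0)"
    then have "(\<Sum>g\<in>G. e g * g) = 0" by (intro sum.neutral) auto
    then show False using e(1) by simp
  qed
  then obtain g0 where g0: "g0 \<in> G" "g0 \<noteq> 0" by auto
  have "fractional_ideal R J"
    unfolding fractional_ideal_def is_submodule_def
  proof (intro conjI)
    show "\<exists>d\<in>R. d \<noteq> 0 \<and> (\<forall>x\<in>J. d * x \<in> R)"
      using g0 sub by (intro bexI[of _ g0]) (auto simp: J_def mult.commute)
  qed (auto simp: J_def distrib_right mult.assoc intro: is_subringD[OF R])
  moreover have "ideal_product (submodule_generated R G) J = R"
  proof (intro equalityI subsetI)
    fix x assume "x \<in> ideal_product (submodule_generated R G) J"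
    then obtain n :: nat and a b where ab: "x = (\<Sum>k<n. a k * b k)"
      "\<And>k. k < n \<Longrightarrow> a k \<in> submodule_generated R G" "\<And>k. k < n \<Longrightarrow> b k \<in> J"
      unfolding ideal_product_def by auto
    have "a k * b k \<in> R" if k: "k < n" for k
    proof -
      obtain c where c: "a k = (\<Sum>g\<in>G. c g * g)" "\<forall>g\<in>G. c g \<in> R"
        using ab(2)[OF k] unfolding submodule_generated_def by auto
      have "a k * b k = (\<Sum>g\<in>G. c g * (b k * g))"
        by (simp add: c(1) sum_distrib_left mult_ac)
      also have "\<dots> \<in> R"
        by (rule is_subring_sum[OF R], rule is_subringD(5)[OF R])
          (use c(2) ab(3)[OF k] in \<open>auto simp: J_def\<close>)
      finally show ?thesis .
    qed
    then show "x \<in> R" unfolding ab(1) by (intro is_subring_sum[OF R]) auto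
  next
    fix x assume x: "x \<in> R"
    define n where "n = card G"
    obtain v where v: "bij_betw v {..<n} G"
      using ex_bij_betw_nat_finite[OF fin] by (auto simp: atLeast0LessThan n_def)
    have vG: "v k \<in> G" if "k < n" for k using v that by (auto simp: bij_betw_def)
    have "x = (\<Sum>g\<in>G. x * g * e g)"
      using arg_cong[OF e(1), of "\<lambda>z. x * z"] by (simp add: sum_distrib_left mult_ac)
    also have "\<dots> = (\<Sum>k<n. (x * v k) * e (v k))"
      by (rule sum.reindex_bij_betw[OF v, symmetric])
    finally show "x \<in> ideal_product (submodule_generated R G) J"
      unfolding ideal_product_def using vG e(2) x gen_scale[OF R x gen_base[OF R fin]]
      by (intro CollectI exI[of _ n] exI[of _ "\<lambda>k. x * v k"] exI[of _ "\<lambda>k. e (v k)"])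
        (auto simp: J_def)
  qed
  ultimately show "invertible_ideal R (submodule_generated R G)"
    unfolding invertible_ideal_def by blast
qed

lemma prufer_partition:
  assumes "prufer_domain R" "finite G" "G \<subseteq> R" "g \<in> G" "g \<noteq> 0"
  obtains e where "(\<Sum>g\<in>G. e g * g) = 1" "\<And>g h. g \<in> G \<Longrightarrow> h \<in> G \<Longrightarrow> e g * h \<in> R"
proof -
  have R: "is_subring R" using assms(1) by (simp add: prufer_domain_def)
  have "submodule_generated R G \<noteq> {0}" using gen_base[OF R assms(2,4)] assms(5) by auto
  then have "invertible_ideal R (submodule_generated R G)"
    using assms(1-3) unfolding prufer_domain_def by blast
  then show ?thesis using that invertible_ideal_iff_partition[OF R assms(2,3)] by blast
qed

text \<open>
  Pairwise solutions suffice. Think of \<open>p g\<close> as supported where \<open>g\<close> divides all other elements of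
  \<open>G\<close>. A new element \<open>c\<close> splits each \<open>p g\<close> into the part \<open>p g * u g\<close>, where \<open>g\<close> also divides
  \<open>c\<close>, and the part \<open>p g * (1 - u g)\<close>, where \<open>c\<close> divides \<open>g\<close> and hence everything.
\<close>

lemma partition_of_pairs:
  assumes R: "is_subring R" and "finite G" "G \<noteq> {}" "0 \<notin> G"
    and pair: "\<And>a b. a \<in> G \<Longrightarrow> b \<in> G \<Longrightarrow> \<exists>u\<in>R. u * a / b \<in> R \<and> (1 - u) * b / a \<in> R"
  shows "\<exists>p. sum p G = 1 \<and> (\<forall>g\<in>G. \<forall>h\<in>G. p g * h / g \<in> R)"
  using assms(2-)
proof (induction G rule: finite_ne_induct)
  case (singleton x)
  then show ?case using is_subringD[OF R] by (intro exI[of _ "\<lambda>_. 1"]) auto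
next
  case (insert c G)
  then have "\<exists>p. sum p G = 1 \<and> (\<forall>g\<in>G. \<forall>h\<in>G. p g * h / g \<in> R)" by simp
  then obtain p where p: "sum p G = 1" "\<And>g h. g \<in> G \<Longrightarrow> h \<in> G \<Longrightarrow> p g * h / g \<in> R" by blast
  have "\<forall>g\<in>G. \<exists>u\<in>R. u * c / g \<in> R \<and> (1 - u) * g / c \<in> R" using insert.prems by auto
  then obtain u where u: "\<And>g. g \<in> G \<Longrightarrow> u g \<in> R" "\<And>g. g \<in> G \<Longrightarrow> u g * c / g \<in> R"
     "\<And>g. g \<in> G \<Longrightarrow> (1 - u g) * g / c \<in> R" by metis
  have nz: "c \<noteq> 0" "g \<noteq> 0" if "g \<in> G" for g using insert.prems that by auto
  have pR: "p g \<in> R" if "g \<in> G" for g using p(2)[OF that that] nz(2)[OF that] by simp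
  define q where "q g = (if g = c then (\<Sum>g\<in>G. p g * (1 - u g)) else p g * u g)" for g
  have "sum q (insert c G) = (\<Sum>g\<in>G. p g * (1 - u g)) + (\<Sum>g\<in>G. p g * u g)"
  proof -
    have "sum q G = (\<Sum>g\<in>G. p g * u g)"
      by (rule sum.cong[OF refl]) (use insert.hyps in \<open>auto simp: q_def\<close>)
    then show ?thesis using insert.hyps by (simp add: q_def)
  qed
  also have "\<dots> = 1" unfolding sum.distrib[symmetric] using p(1) by (simp add: algebra_simps)
  finally have "sum q (insert c G) = 1" .
  moreover have "q g * h / g \<in> R" if gh: "g \<in> insert c G" "h \<in> insert c G" for g h
  proof (cases "g = c")
    case True
    have "p i * (1 - u i) * h / c \<in> R" if i: "i \<in> G" for i
    proof (cases "h = c")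
      case True
      then show ?thesis using pR[OF i] u(1)[OF i] nz[OF i] is_subringD[OF R] by simp
    next
      case False
      then have "p i * h / i * ((1 - u i) * i / c) \<in> R"
        using gh p(2)[OF i] u(3)[OF i] by (intro is_subringD[OF R]) auto
      moreover have "p i * h / i * ((1 - u i) * i / c) = p i * (1 - u i) * h / c"
        using nz[OF i] by simp
      ultimately show ?thesis by metis
    qed
    then have "(\<Sum>i\<in>G. p i * (1 - u i) * h / c) \<in> R" by (rule is_subring_sum[OF R])
    then show ?thesis using True by (simp add: q_def sum_distrib_right sum_divide_distrib)
  next
    case False
    then have g: "g \<in> G" using gh by simp
    have "p g * u g * h / g \<in> R"
    proof (cases "h = c")
      case True
      have "p g * (u g * c / g) \<in> R" using pR[OF g] u(2)[OF g] by (rule is_subringD[OF R])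
      then show ?thesis using True by (simp add: mult.assoc)
    next
      case False
      then have "p g * h / g * u g \<in> R"
        using gh p(2)[OF g] u(1)[OF g] by (intro is_subringD[OF R]) auto
      then show ?thesis by (simp add: field_simps)
    qed
    then show ?thesis using False by (simp add: q_def)
  qed
  ultimately show ?case by blast
qed

lemma prufer_domain_iff_pairs:
  "prufer_domain R \<longleftrightarrow> is_subring R \<and>
     (\<forall>a\<in>R - {0}. \<forall>b\<in>R - {0}. \<exists>u\<in>R. u * a / b \<in> R \<and> (1 - u) * b / a \<in> R)"
proof (intro iffI conjI ballI)
  assume P: "prufer_domain R"
  then show R: "is_subring R" by (simp add: prufer_domain_def)
  fix a b assume a: "a \<in> R - {0}" and b: "b \<in> R - {0}"
  show "\<exists>u\<in>R. u * a / b \<in> R \<and> (1 - u) * b / a \<in> R"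
  proof (cases "a = b")
    case True
    then show ?thesis using a is_subringD[OF R] by (intro bexI[of _ 1]) auto
  next
    case False
    obtain e where e: "(\<Sum>g\<in>{a, b}. e g * g) = 1" "\<And>g h. g \<in> {a, b} \<Longrightarrow> h \<in> {a, b} \<Longrightarrow> e g * h \<in> R"
      using prufer_partition[OF P, of "{a, b}" a] a b by auto
    have "1 - e b * b = e a * a" using e(1) False by (simp add: algebra_simps)
    then show ?thesis using e(2) a b by (intro bexI[of _ "e b * b"]) auto
  qed
next
  assume *: "is_subring R \<and> (\<forall>a\<in>R - {0}. \<forall>b\<in>R - {0}. \<exists>u\<in>R. u * a / b \<in> R \<and> (1 - u) * b / a \<in> R)"
  then have R: "is_subring R" by simp
  show "prufer_domain R" unfolding prufer_domain_def
  proof (intro conjI R allI impI)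
    fix G assume G: "finite G \<and> G \<subseteq> R \<and> submodule_generated R G \<noteq> {0}"
    have "G - {0} \<noteq> {}"
    proof
      assume "G - {0} = {}"
      then have "(\<Sum>g\<in>G. c g * g) = 0" for c by (intro sum.neutral) auto
      then have "submodule_generated R G \<subseteq> {0}" by (auto simp: submodule_generated_def)
      then show False using G gen_zero[OF R] by blast
    qed
    moreover have "\<exists>u\<in>R. u * a / b \<in> R \<and> (1 - u) * b / a \<in> R" if "a \<in> G - {0}" "b \<in> G - {0}" for a b
      using * that G by blast
    ultimately obtain p where p: "sum p (G - {0}) = 1" "\<forall>g\<in>G - {0}. \<forall>h\<in>G - {0}. p g * h / g \<in> R"
      using partition_of_pairs[OF R, of "G - {0}"] G by auto
    define e where "e g = (if g = 0 then 0 else p g / g)" for g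
    have "(\<Sum>g\<in>G. e g * g) = (\<Sum>g\<in>G - {0}. e g * g)"
      using G by (intro sum.mono_neutral_right) auto
    also have "\<dots> = 1" unfolding p(1)[symmetric] by (intro sum.cong) (auto simp: e_def)
    finally have "(\<Sum>g\<in>G. e g * g) = 1" .
    moreover have "e g * h \<in> R" if "g \<in> G" "h \<in> G" for g h
      using that p(2) is_subringD(1)[OF R] by (cases "g = 0 \<or> h = 0") (auto simp: e_def)
    ultimately show "invertible_ideal R (submodule_generated R G)"
      using invertible_ideal_iff_partition[OF R] G by blast
  qed
qed

section \<open>Polynomials over a field and their values in the algebraic closure\<close>

interpretation to_ac: map_poly_comm_ring_hom to_ac
  by unfold_locales auto

definition ac_eval :: "'k::field poly \<Rightarrow> 'k alg_closure \<Rightarrow> 'k alg_closure" where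
  "ac_eval f \<alpha> = poly (map_poly to_ac f) \<alpha>"

lemma ac_eval_simps [simp]:
  "ac_eval 0 \<alpha> = 0" "ac_eval 1 \<alpha> = 1" "ac_eval (f + g) \<alpha> = ac_eval f \<alpha> + ac_eval g \<alpha>"
  "ac_eval (f - g) \<alpha> = ac_eval f \<alpha> - ac_eval g \<alpha>" "ac_eval (- f) \<alpha> = - ac_eval f \<alpha>"
  "ac_eval (f * g) \<alpha> = ac_eval f \<alpha> * ac_eval g \<alpha>" "ac_eval (f ^ n) \<alpha> = ac_eval f \<alpha> ^ n"
  "ac_eval (pCons a f) \<alpha> = to_ac a + \<alpha> * ac_eval f \<alpha>"
  "ac_eval (smult a f) \<alpha> = to_ac a * ac_eval f \<alpha>"
  by (simp_all add: ac_eval_def hom_distribs)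

lemma ac_eval_sum: "ac_eval (sum f I) \<alpha> = (\<Sum>i\<in>I. ac_eval (f i) \<alpha>)"
  by (induction I rule: infinite_finite_induct) auto

lemma ac_eval_prod: "ac_eval (prod f I) \<alpha> = (\<Prod>i\<in>I. ac_eval (f i) \<alpha>)"
  by (induction I rule: infinite_finite_induct) auto

lemma poly_ideal_principal:
  fixes I :: "'k::field poly set"
  assumes "0 \<in> I" "\<And>f g. f \<in> I \<Longrightarrow> g \<in> I \<Longrightarrow> f + g \<in> I" "\<And>f g. g \<in> I \<Longrightarrow> f * g \<in> I"
  shows "\<exists>g\<in>I. \<forall>f\<in>I. g dvd f"
proof (cases "I = {0}")
  case False
  then have "\<exists>g. g \<in> I \<and> g \<noteq> 0" using assms(1) by auto
  then obtain g where g: "g \<in> I" "g \<noteq> 0" "\<And>h. h \<in> I \<Longrightarrow> h \<noteq> 0 \<Longrightarrow> degree g \<le> degree h"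
    using ex_has_least_nat[of "\<lambda>g. g \<in> I \<and> g \<noteq> 0" _ degree] by blast
  have "g dvd f" if "f \<in> I" for f
  proof (rule ccontr)
    assume "\<not> g dvd f"
    then have nz: "f mod g \<noteq> 0" by auto
    have "f mod g = f + (- (f div g)) * g" by (simp add: minus_div_mult_eq_mod)
    then have "f mod g \<in> I" using assms(2,3) g(1) that by metis
    then have "degree g \<le> degree (f mod g)" using g(3) nz by blast
    then show False using degree_mod_less[OF g(2), of f] nz by simp
  qed
  then show ?thesis using g(1) by blast
qed auto

lemma poly_bezout:
  fixes f g :: "'k::field poly"
  obtains d a b where "d = a * f + b * g" "d dvd f" "d dvd g"
proof -
  define I where "I = {a * f + b * g | a b. True}"
  have "\<exists>d\<in>I. \<forall>h\<in>I. d dvd h"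
  proof (rule poly_ideal_principal)
    show "0 \<in> I" unfolding I_def by (intro CollectI exI[of _ 0]) simp
    show "x + y \<in> I" if xy: "x \<in> I" "y \<in> I" for x y
    proof -
      obtain a b a' b' where "x = a * f + b * g" "y = a' * f + b' * g" using xy by (auto simp: I_def)
      then have "x + y = (a + a') * f + (b + b') * g" by (simp add: algebra_simps)
      then show ?thesis unfolding I_def by blast
    qed
    show "x * y \<in> I" if y: "y \<in> I" for x y
    proof -
      obtain a b where "y = a * f + b * g" using y by (auto simp: I_def)
      then have "x * y = (x * a) * f + (x * b) * g" by (simp add: algebra_simps)
      then show ?thesis unfolding I_def by blast
    qed
  qed
  then obtain d where d: "d \<in> I" "\<forall>h\<in>I. d dvd h" by blast
  have "f = 1 * f + 0 * g" "g = 0 * f + 1 * g" by auto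
  then have "f \<in> I" "g \<in> I" unfolding I_def by blast+
  then have "d dvd f" "d dvd g" using d(2) by auto
  moreover obtain a b where "d = a * f + b * g" using d(1) unfolding I_def by blast
  ultimately show ?thesis by (intro that)
qed

lemma poly_fract_reduced:
  fixes x :: "'k::field poly fract"
  obtains f g a b where "x = to_fract f / to_fract g" "g \<noteq> 0" "a * f + b * g = 1"
proof -
  obtain f g where fg: "x = to_fract f / to_fract g" "g \<noteq> 0"
    by (metis Fract_cases Fract_conv_to_fract)
  obtain d a b where d: "d = a * f + b * g" "d dvd f" "d dvd g" by (rule poly_bezout)
  then obtain f' g' where f': "f = d * f'" "g = d * g'" by (metis dvdE)
  have dnz: "d \<noteq> 0" "g' \<noteq> 0" using fg(2) f' by auto
  have "d * (a * f' + b * g') = d * 1" using d(1) unfolding f' by (simp add: algebra_simps)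
  then have "a * f' + b * g' = 1" using dnz(1) by (metis mult_left_cancel)
  moreover have "x = to_fract f' / to_fract g'" using fg(1) dnz by (simp add: f')
  ultimately show ?thesis using that dnz(2) by blast
qed

lemma to_fract_power: "to_fract (x ^ n) = to_fract x ^ n"
  by (induction n) auto

lemma range_to_fract_subring: "is_subring (range to_fract)"
  unfolding is_subring_def
  by (auto simp flip: to_fract_0 to_fract_1 to_fract_add to_fract_mult to_fract_uminus)

text \<open>
  The rational root argument: if \<open>f/g\<close> with \<open>f\<close>, \<open>g\<close> coprime satisfies a monic equation, then \<open>g\<close>
  divides a power of \<open>f\<close> and is a unit.
\<close>

lemma poly_integrally_closed:
  fixes x :: "'k::field poly fract"
  assumes "integral_over (range to_fract) x"
  shows "x \<in> range to_fract"
proof -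
  obtain n c where c: "\<forall>i<n. c i \<in> range to_fract" "x ^ n + (\<Sum>i<n. c i * x ^ i) = 0"
    using assms unfolding integral_over_iff[OF range_to_fract_subring] by auto
  from c(1) have "\<forall>i\<in>{..<n}. \<exists>r. c i = to_fract r" by auto
  then obtain r where r: "\<And>i. i < n \<Longrightarrow> c i = to_fract (r i)" by (metis lessThan_iff)
  obtain f g a b where fg: "x = to_fract f / to_fract g" "g \<noteq> 0" "a * f + b * g = 1"
    by (rule poly_fract_reduced)
  have "0 = to_fract g ^ n * (x ^ n + (\<Sum>i<n. c i * x ^ i))" using c(2) by simp
  also have "\<dots> = to_fract g ^ n * x ^ n + (\<Sum>i<n. c i * (to_fract g ^ n * x ^ i))"
    by (simp add: distrib_left sum_distrib_left mult_ac)
  also have "to_fract g ^ n * x ^ n = to_fract (f ^ n)"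
    using fg(1,2) by (simp add: power_divide to_fract_power)
  also have "(\<Sum>i<n. c i * (to_fract g ^ n * x ^ i)) = (\<Sum>i<n. to_fract (r i * g ^ (n - i) * f ^ i))"
  proof (intro sum.cong refl)
    fix i assume i: "i \<in> {..<n}"
    then have "to_fract g ^ n = to_fract g ^ (n - i) * to_fract g ^ i"
      by (simp flip: power_add)
    then show "c i * (to_fract g ^ n * x ^ i) = to_fract (r i * g ^ (n - i) * f ^ i)"
      using i fg(1,2) by (simp add: r power_divide to_fract_power)
  qed
  finally have "to_fract (f ^ n + (\<Sum>i<n. r i * g ^ (n - i) * f ^ i)) = 0" by simp
  then have "f ^ n = - (\<Sum>i<n. r i * g ^ (n - i) * f ^ i)"
    by (simp only: to_fract_eq_0_iff eq_neg_iff_add_eq_0)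
  moreover have "g dvd (\<Sum>i<n. r i * g ^ (n - i) * f ^ i)"
    by (intro dvd_sum dvd_mult2 dvd_mult) auto
  ultimately have "g dvd f ^ n" by simp
  moreover have "g dvd f ^ k \<Longrightarrow> g dvd 1" for k
  proof (induction k)
    case (Suc k)
    have "f ^ k = a * f ^ Suc k + g * (b * f ^ k)"
      using arg_cong[OF fg(3), of "\<lambda>z. z * f ^ k"] by (simp add: algebra_simps)
    then have "g dvd f ^ k" using Suc.prems by (metis dvd_add dvd_mult dvd_triv_left)
    then show ?case by (rule Suc.IH)
  qed simp
  ultimately have "g dvd 1" by blast
  then obtain e where "1 = g * e" by (rule dvdE)
  then have "to_fract g * to_fract e = 1" by (metis to_fract_mult to_fract_1)
  then have "inverse (to_fract g) = to_fract e" by (rule inverse_unique)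
  then have "x = to_fract (f * e)" using fg(1) by (simp add: divide_inverse)
  then show ?thesis by (rule range_eqI)
qed

text \<open>
  \<open>K[\<alpha>]\<close> is a field, so every value that is a quotient of values at \<open>\<alpha>\<close> is again
  the value of a polynomial over \<open>K\<close>.
\<close>

lemma ac_eval_inverse:
  assumes "ac_eval f \<alpha> \<noteq> 0"
  obtains g where "ac_eval g \<alpha> * ac_eval f \<alpha> = 1"
proof -
  have "\<exists>\<pi>\<in>{h. ac_eval h \<alpha> = 0}. \<forall>h\<in>{h. ac_eval h \<alpha> = 0}. \<pi> dvd h"
    by (rule poly_ideal_principal) auto
  then obtain \<pi> where \<pi>: "ac_eval \<pi> \<alpha> = 0" "\<And>h. ac_eval h \<alpha> = 0 \<Longrightarrow> \<pi> dvd h" by auto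
  obtain p where "p \<noteq> 0" "ac_eval p \<alpha> = 0" unfolding ac_eval_def by (rule alg_closure_algebraic)
  then have nz: "\<pi> \<noteq> 0" using \<pi>(2) by auto
  obtain d a b where d: "d = a * \<pi> + b * f" "d dvd \<pi>" "d dvd f" by (rule poly_bezout)
  obtain e where e: "\<pi> = d * e" using d(2) by (auto simp: dvd_def)
  have "ac_eval d \<alpha> \<noteq> 0" using d(3) assms by (auto simp: dvd_def)
  then have "ac_eval e \<alpha> = 0" using \<pi>(1) by (simp add: e)
  then obtain h where "e = \<pi> * h" using \<pi>(2) by (metis dvdE)
  then have "e * 1 = e * (d * h)" by (metis e mult.assoc mult.commute mult_1_right)
  then have "d * h = 1" using nz e by (metis mult_left_cancel mult_zero_right)
  then have "ac_eval d \<alpha> * ac_eval h \<alpha> = 1" by (metis ac_eval_simps(2,6))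
  then have "ac_eval (b * h) \<alpha> * ac_eval f \<alpha> = 1" using \<pi>(1) by (simp add: d(1) mult_ac)
  then show ?thesis by (rule that)
qed

text \<open>
  All elements of the algebraic closure are algebraic over the base field, so this relation is
  conjugacy.
\<close>

definition specializes :: "'k::field alg_closure \<Rightarrow> 'k alg_closure \<Rightarrow> bool" where
  "specializes \<alpha> \<beta> \<longleftrightarrow> (\<forall>h. ac_eval h \<alpha> = 0 \<longrightarrow> ac_eval h \<beta> = 0)"

text \<open>
  Chinese remaindering for minimal polynomials, arranged as an induction over the points. A point
  conjugate to an earlier one is served by the polynomial found so far. For any other point there is
  \<open>m\<close> that vanishes at the earlier points but not at the new one, and a multiple of \<open>m\<close> corrects the
  value there.
\<close>

lemma ac_eval_interpolation:
  assumes "finite Z" and ex: "\<And>\<alpha>. \<alpha> \<in> Z \<Longrightarrow> \<exists>t. Q \<alpha> (ac_eval t \<alpha>)"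
    and spec: "\<And>\<alpha> \<beta> t. \<alpha> \<in> Z \<Longrightarrow> \<beta> \<in> Z \<Longrightarrow> specializes \<alpha> \<beta> \<Longrightarrow> Q \<alpha> (ac_eval t \<alpha>) \<Longrightarrow> Q \<beta> (ac_eval t \<beta>)"
  shows "\<exists>t. \<forall>\<alpha>\<in>Z. Q \<alpha> (ac_eval t \<alpha>)"
  using assms
proof (induction Z rule: finite_induct)
  case (insert \<alpha> Z)
  have "\<exists>t. \<forall>\<alpha>\<in>Z. Q \<alpha> (ac_eval t \<alpha>)"
    by (rule insert.IH) (use insert.prems in blast)+
  then obtain t where t: "\<forall>\<alpha>\<in>Z. Q \<alpha> (ac_eval t \<alpha>)" by blast
  show ?case
  proof (cases "\<exists>\<beta>\<in>Z. specializes \<beta> \<alpha>")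
    case True
    then show ?thesis using t insert.prems(2) by blast
  next
    case False
    then have "\<forall>\<beta>\<in>Z. \<exists>h. ac_eval h \<beta> = 0 \<and> ac_eval h \<alpha> \<noteq> 0" by (auto simp: specializes_def)
    then obtain h where h: "\<And>\<beta>. \<beta> \<in> Z \<Longrightarrow> ac_eval (h \<beta>) \<beta> = 0" "\<And>\<beta>. \<beta> \<in> Z \<Longrightarrow> ac_eval (h \<beta>) \<alpha> \<noteq> 0"
      by metis
    define m where "m = prod h Z"
    have "ac_eval m \<alpha> \<noteq> 0" using insert.hyps h(2) by (simp add: m_def ac_eval_prod)
    then obtain c where c: "ac_eval c \<alpha> * ac_eval m \<alpha> = 1" by (rule ac_eval_inverse)
    obtain s where s: "Q \<alpha> (ac_eval s \<alpha>)" using insert.prems(1) by blast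
    define r where "r = t + c * m * (s - t)"
    have "ac_eval r \<alpha> = ac_eval s \<alpha>" using c by (simp add: r_def)
    moreover have "ac_eval r \<beta> = ac_eval t \<beta>" if "\<beta> \<in> Z" for \<beta>
    proof -
      have "ac_eval m \<beta> = 0" using insert.hyps h(1) that by (auto simp: m_def ac_eval_prod)
      then show ?thesis by (simp add: r_def)
    qed
    ultimately show ?thesis using s t by (intro exI[of _ r]) auto
  qed
qed simp

section \<open>Algebraic elements integral over a domain\<close>

text \<open>
  The ring \<open>O\<close>: the integral closure of \<open>D\<close> in the algebraic closure of its quotient field.
\<close>

definition alg_ints :: "'d::idom fract alg_closure set" where
  "alg_ints = integral_closure (range (\<lambda>d. to_ac (to_fract d)))"

lemma range_to_ac_subring: "is_subring (range (\<lambda>d::'d::idom. to_ac (to_fract d)))"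
  unfolding is_subring_def
  by (auto simp flip: to_fract_0 to_fract_1 to_fract_add to_fract_mult to_fract_uminus
      to_ac_0 to_ac_1 to_ac_add to_ac_mult to_ac_minus)

lemmas alg_ints_subring = integral_closure_subring[OF range_to_ac_subring, folded alg_ints_def]

lemma alg_ints_0 [simp]: "0 \<in> alg_ints" and alg_ints_1 [simp]: "1 \<in> alg_ints"
  by (rule is_subringD[OF alg_ints_subring])+

lemma to_fract_in_alg_ints [simp]: "to_ac (to_fract d) \<in> alg_ints"
  unfolding alg_ints_def using subset_integral_closure[OF range_to_ac_subring] by auto

lemma alg_ints_monic_root:
  assumes "\<And>i. i < n \<Longrightarrow> c i \<in> alg_ints" "y ^ n + (\<Sum>i<n. c i * y ^ i) = 0"
  shows "y \<in> alg_ints"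
proof -
  have "integral_over alg_ints y"
    unfolding integral_over_iff[OF alg_ints_subring] using assms by blast
  then show ?thesis unfolding alg_ints_def by (rule integral_closure_idem[OF range_to_ac_subring])
qed

lemma alg_intsE:
  assumes "y \<in> alg_ints"
  obtains n :: nat and d where "y ^ n + (\<Sum>i<n. to_ac (to_fract (d i)) * y ^ i) = 0"
proof -
  obtain n c where c: "\<forall>i<n. c i \<in> range (\<lambda>d. to_ac (to_fract d))" "y ^ n + (\<Sum>i<n. c i * y ^ i) = 0"
    using assms unfolding alg_ints_def integral_closure_def integral_over_iff[OF range_to_ac_subring] by auto
  from c(1) have "\<forall>i\<in>{..<n}. \<exists>d. c i = to_ac (to_fract d)" by auto
  then obtain d where "\<And>i. i < n \<Longrightarrow> c i = to_ac (to_fract (d i))" by (metis lessThan_iff)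
  then have "(\<Sum>i<n. c i * y ^ i) = (\<Sum>i<n. to_ac (to_fract (d i)) * y ^ i)" by (intro sum.cong) auto
  then show ?thesis using that[of n d] c(2) by simp
qed

lemma to_ac_in_alg_ints_iff:
  assumes "integrally_closed_domain TYPE('d::idom)"
  shows "to_ac y \<in> alg_ints \<longleftrightarrow> y \<in> range (to_fract :: 'd \<Rightarrow> 'd fract)"
proof
  assume "to_ac y \<in> alg_ints"
  then obtain n and d :: "nat \<Rightarrow> 'd"
    where "to_ac y ^ n + (\<Sum>i<n. to_ac (to_fract (d i)) * to_ac y ^ i) = 0" by (rule alg_intsE)
  then have "to_ac (y ^ n + (\<Sum>i<n. to_fract (d i) * y ^ i)) = 0" by (simp add: to_ac_sum)
  then have "y ^ n + (\<Sum>i<n. to_fract (d i) * y ^ i) = 0" by (simp only: to_ac_eq_0_iff)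
  then have "integral_over (range (to_fract :: 'd \<Rightarrow> 'd fract)) y"
    unfolding integral_over_iff[OF range_to_fract_subring]
    by (intro exI[of _ n] exI[of _ "\<lambda>i. to_fract (d i)"]) simp
  then show "y \<in> range (to_fract :: 'd \<Rightarrow> 'd fract)"
    using assms unfolding integrally_closed_domain_def integral_closure_def by auto
qed auto

text \<open>
  An integral equation for \<open>h(\<alpha>)\<close> is a polynomial condition on \<open>\<alpha>\<close>, hence holds at every conjugate.
\<close>

lemma specializes_alg_ints:
  assumes "specializes \<alpha> \<beta>" "ac_eval h \<alpha> \<in> alg_ints"
  shows "ac_eval h \<beta> \<in> alg_ints"
proof -
  obtain n d where d: "ac_eval h \<alpha> ^ n + (\<Sum>i<n. to_ac (to_fract (d i)) * ac_eval h \<alpha> ^ i) = 0"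
    using assms(2) by (rule alg_intsE)
  define H where "H = h ^ n + (\<Sum>i<n. smult (to_fract (d i)) (h ^ i))"
  have "ac_eval H \<alpha> = 0" using d by (simp add: H_def ac_eval_sum)
  then have "ac_eval H \<beta> = 0" using assms(1) by (simp add: specializes_def)
  then have "ac_eval h \<beta> ^ n + (\<Sum>i<n. to_ac (to_fract (d i)) * ac_eval h \<beta> ^ i) = 0"
    by (simp add: H_def ac_eval_sum)
  then show ?thesis by (rule alg_ints_monic_root[rotated]) simp
qed

lemma common_denominator:
  assumes "finite A"
  shows "\<exists>d::'d::idom. d \<noteq> 0 \<and> (\<forall>x\<in>A. to_fract d * x \<in> range to_fract)"
  using assms
proof (induction A rule: finite_induct)
  case empty
  show ?case by (intro exI[of _ 1]) auto
next
  case (insert x A)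
  from insert.IH obtain d :: 'd where d: "d \<noteq> 0" "\<forall>x\<in>A. to_fract d * x \<in> range to_fract"
    by blast
  obtain a b where ab: "x = to_fract a / to_fract b" "b \<noteq> 0"
    by (metis Fract_cases Fract_conv_to_fract)
  have "to_fract (d * b) * x = to_fract (d * a)" using ab by simp
  then have x: "to_fract (d * b) * x \<in> range to_fract" by (rule range_eqI)
  have z: "to_fract (d * b) * z \<in> range to_fract" if "z \<in> A" for z
  proof -
    have "to_fract d * z \<in> range to_fract" using d(2) that by (rule bspec)
    then obtain r where r: "to_fract d * z = to_fract r" by (rule rangeE)
    have "to_fract (d * b) * z = to_fract b * (to_fract d * z)"
      by (simp only: to_fract_mult mult_ac)
    also have "\<dots> = to_fract (b * r)" by (simp only: r to_fract_mult)
    finally show ?thesis by (rule range_eqI)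
  qed
  show ?case
  proof (intro exI[of _ "d * b"] conjI ballI)
    show "d * b \<noteq> 0" using d(1) ab(2) by simp
    show "to_fract (d * b) * w \<in> range to_fract" if "w \<in> insert x A" for w
      using that by (rule insertE) (use x z in \<open>simp_all only:\<close>)
  qed
qed

text \<open>
  Here \<open>b s = c s + c (s+1) y + c (s+2) y^2 + ...\<close> are the truncations of a relation
  \<open>c 0 + c 1 y + ... = 0\<close>. The relation reads \<open>b s * y ^ s + c (s-1) y ^ (s-1) + ... + c 0 = 0\<close>;
  multiplied by \<open>b s ^ (s-1)\<close> it becomes a monic equation for \<open>y * b s\<close>. So integrality
  propagates from \<open>y * b (s+1)\<close> to \<open>b s\<close> and from there to \<open>y * b s\<close>.
\<close>

lemma truncated_relation_integral:
  assumes step: "\<And>s. b s = c s + y * b (Suc s)" and c: "\<And>s. c s \<in> alg_ints"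
    and "b 0 = 0" "b N = 0" and "s \<le> N"
  shows "b s \<in> alg_ints \<and> y * b s \<in> alg_ints"
  using \<open>s \<le> N\<close>
proof (induction s rule: inc_induct)
  case base
  then show ?case using \<open>b N = 0\<close> by simp
next
  case (step s)
  have bs: "b s \<in> alg_ints"
    unfolding assms(1)[of s] using step.IH c is_subringD(4)[OF alg_ints_subring] by blast
  have rel: "b s * y ^ s + (\<Sum>i<s. c i * y ^ i) = 0" for s
  proof (induction s)
    case (Suc s)
    then show ?case using assms(1)[of s] by (simp add: algebra_simps)
  qed (use \<open>b 0 = 0\<close> in simp)
  have "y * b s \<in> alg_ints"
  proof (cases s)
    case 0
    then show ?thesis using \<open>b 0 = 0\<close> by simp
  next
    case (Suc k)
    have "(\<Sum>i<s. c i * b s ^ (k - i) * (y * b s) ^ i) = b s ^ k * (\<Sum>i<s. c i * y ^ i)"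
      unfolding sum_distrib_left
    proof (intro sum.cong refl)
      fix i assume "i \<in> {..<s}"
      then have "b s ^ k = b s ^ (k - i) * b s ^ i" using Suc by (simp flip: power_add)
      then show "c i * b s ^ (k - i) * (y * b s) ^ i = b s ^ k * (c i * y ^ i)"
        by (simp add: power_mult_distrib)
    qed
    moreover have "(y * b s) ^ s = b s ^ k * (b s * y ^ s)"
      using Suc by (simp add: power_mult_distrib)
    ultimately have "(y * b s) ^ s + (\<Sum>i<s. c i * b s ^ (k - i) * (y * b s) ^ i) =
      b s ^ k * (b s * y ^ s + (\<Sum>i<s. c i * y ^ i))"
      by (simp only: distrib_left)
    then have "(y * b s) ^ s + (\<Sum>i<s. c i * b s ^ (k - i) * (y * b s) ^ i) = 0"
      by (simp only: rel mult_zero_right)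
    moreover have "c i * b s ^ (k - i) \<in> alg_ints" for i
      by (intro is_subringD(5)[OF alg_ints_subring] is_subring_power[OF alg_ints_subring] bs c)
    ultimately show ?thesis by (rule alg_ints_monic_root[rotated])
  qed
  then show ?case using bs by blast
qed

text \<open>
  Take a relation of \<open>y\<close> with coefficients \<open>c i\<close> in \<open>D\<close>. They generate an invertible ideal, so
  \<open>1 = \<Sum> e g * g\<close> over the coefficients \<open>g\<close>, with every \<open>e g * c i\<close> in \<open>D\<close>. Replace each \<open>g = c i\<close> by
  \<open>b i - y * b (i+1)\<close>, a combination of two truncations. This splits \<open>1\<close> into \<open>u + y * q\<close>, where \<open>u\<close>,
  \<open>u * y\<close> and \<open>q\<close> are integral because \<open>e g\<close> times the relation is again a relation over
  \<open>D\<close>. That \<open>u\<close> is a value of a polynomial over \<open>K\<close> at \<open>y\<close> matters later, for \<open>u\<close> has to stay in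
  \<open>K[\<alpha>]\<close>.
\<close>

lemma prufer_pair_in_alg_ints:
  fixes y :: "'d::idom fract alg_closure"
  assumes "prufer_domain (range (to_fract :: 'd \<Rightarrow> 'd fract))"
  obtains U q where "ac_eval U y \<in> alg_ints" "ac_eval U y * y \<in> alg_ints"
    "q \<in> alg_ints" "1 - ac_eval U y = y * q"
proof -
  let ?R = "range (to_fract :: 'd \<Rightarrow> 'd fract)"
  obtain p where p: "p \<noteq> 0" "ac_eval p y = 0" unfolding ac_eval_def by (rule alg_closure_algebraic)
  obtain d :: 'd where d: "d \<noteq> 0" "\<forall>x\<in>set (coeffs p). to_fract d * x \<in> ?R"
    using common_denominator[OF List.finite_set[of "coeffs p"]] by (elim exE conjE)
  define c where "c = smult (to_fract d) p"
  have cR: "coeff c i \<in> ?R" for i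
    using d(2) coeff_in_coeffs[OF p(1), of i] is_subringD(1)[OF range_to_fract_subring]
    by (cases "i \<le> degree p") (auto simp: c_def coeff_eq_0)
  have cy: "c \<noteq> 0" "ac_eval c y = 0" using p d(1) by (auto simp: c_def)
  define G where "G = coeff c ` {..degree c}"
  obtain e where e: "(\<Sum>g\<in>G. e g * g) = 1" "\<And>g h. g \<in> G \<Longrightarrow> h \<in> G \<Longrightarrow> e g * h \<in> ?R"
  proof (rule prufer_partition[OF assms, of G "lead_coeff c"])
    show "finite G" by (simp add: G_def)
    show "G \<subseteq> ?R" using cR by (auto simp only: G_def)
    show "lead_coeff c \<in> G" by (simp add: G_def)
    show "lead_coeff c \<noteq> 0" using cy(1) by simp
  qed (rule that)
  have "\<forall>g\<in>G. \<exists>i. coeff c i = g" unfolding G_def by blast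
  then obtain i where i: "\<And>g. g \<in> G \<Longrightarrow> coeff c (i g) = g" by metis
  define B where "B g s = ac_eval (poly_shift s (smult (e g) c)) y" for g s
  have shift: "poly_shift s q = pCons (coeff q s) (poly_shift (Suc s) q)" for s and q :: "'d fract poly"
    by (rule poly_eqI) (auto simp: coeff_poly_shift coeff_pCons split: nat.splits)
  have step: "B g s = to_ac (coeff (smult (e g) c) s) + y * B g (Suc s)" for g s
    unfolding B_def by (subst shift) simp
  have coeff: "to_ac (coeff (smult (e g) c) s) \<in> alg_ints" if "g \<in> G" for g s
  proof (cases "s \<le> degree c")
    case True
    then have "e g * coeff c s \<in> ?R" using e(2)[OF that] by (auto simp: G_def)
    then obtain r where "e g * coeff c s = to_fract r" by (rule rangeE)
    then show ?thesis by (simp only: coeff_smult to_fract_in_alg_ints)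
  next
    case False
    then show ?thesis by (simp add: coeff_eq_0)
  qed
  have B: "B g s \<in> alg_ints \<and> y * B g s \<in> alg_ints" if g: "g \<in> G" for g s
  proof -
    have zero: "B g t = 0" if "degree c < t" for t
    proof -
      have "poly_shift t (smult (e g) c) = 0"
        using that by (intro poly_eqI) (simp add: coeff_poly_shift coeff_eq_0)
      then show ?thesis by (simp add: B_def)
    qed
    show ?thesis
    proof (rule truncated_relation_integral[where c = "\<lambda>s. to_ac (coeff (smult (e g) c) s)"])
      show "B g 0 = 0" using cy(2) by (simp add: B_def)
      show "B g (s + Suc (degree c)) = 0" by (rule zero) simp
      show "B g t = to_ac (coeff (smult (e g) c) t) + y * B g (Suc t)" for t by (rule step)
      show "to_ac (coeff (smult (e g) c) t) \<in> alg_ints" for t by (rule coeff[OF g])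
    qed simp
  qed
  define U where "U = (\<Sum>g\<in>G. poly_shift (i g) (smult (e g) c))"
  have U: "ac_eval U y = (\<Sum>g\<in>G. B g (i g))" by (simp add: U_def B_def ac_eval_sum)
  have "ac_eval U y = (\<Sum>g\<in>G. to_ac (e g * g) + y * B g (Suc (i g)))"
    unfolding U
  proof (intro sum.cong refl)
    fix g assume "g \<in> G"
    then have "to_ac (coeff (smult (e g) c) (i g)) = to_ac (e g * g)" by (simp add: i)
    then show "B g (i g) = to_ac (e g * g) + y * B g (Suc (i g))" using step[of g "i g"] by metis
  qed
  also have "\<dots> = 1 + y * (\<Sum>g\<in>G. B g (Suc (i g)))"
    unfolding sum.distrib sum_distrib_left to_ac_sum[symmetric] e(1) by simp
  finally have "1 - ac_eval U y = y * (- (\<Sum>g\<in>G. B g (Suc (i g))))" by simp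
  moreover have "- (\<Sum>g\<in>G. B g (Suc (i g))) \<in> alg_ints"
    using B by (intro is_subringD(3)[OF alg_ints_subring] is_subring_sum[OF alg_ints_subring]) auto
  moreover have "ac_eval U y \<in> alg_ints"
    unfolding U using B by (intro is_subring_sum[OF alg_ints_subring]) auto
  moreover have "ac_eval U y * y = (\<Sum>g\<in>G. y * B g (i g))"
    by (simp add: U sum_distrib_left mult.commute[of _ y])
  then have "ac_eval U y * y \<in> alg_ints"
    using B by (auto intro!: is_subring_sum[OF alg_ints_subring])
  ultimately show ?thesis using that by blast
qed

section \<open>Polynomials with integral values on a finite set\<close>

definition integral_on :: "'d::idom fract alg_closure set \<Rightarrow> 'd fract poly set" where
  "integral_on Z = {f. \<forall>\<alpha>\<in>Z. ac_eval f \<alpha> \<in> alg_ints}"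

lemma integral_on_subring: "is_subring (to_fract ` integral_on Z)"
proof -
  have "0 \<in> integral_on Z" "1 \<in> integral_on Z" "\<And>f. f \<in> integral_on Z \<Longrightarrow> - f \<in> integral_on Z"
    "\<And>f g. f \<in> integral_on Z \<Longrightarrow> g \<in> integral_on Z \<Longrightarrow> f + g \<in> integral_on Z"
    "\<And>f g. f \<in> integral_on Z \<Longrightarrow> g \<in> integral_on Z \<Longrightarrow> f * g \<in> integral_on Z"
    by (auto simp: integral_on_def intro: is_subringD[OF alg_ints_subring])
  then show ?thesis
    unfolding is_subring_def
    by (auto simp flip: to_fract_0 to_fract_1 to_fract_add to_fract_mult to_fract_uminus)
qed

lemma ac_eval_pcompose: "ac_eval (pcompose U p) \<alpha> = ac_eval U (ac_eval p \<alpha>)"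
  by (induction U) (simp_all add: pcompose_pCons)

text \<open>
  The values at \<open>\<alpha>\<close> are \<open>f = F(\<alpha>)\<close> and \<open>g = G(\<alpha>)\<close>, not both zero. If both are non-zero, the right
  value of \<open>v + t F\<close> is \<open>u/g\<close>, where \<open>u\<close> solves the criterion for \<open>f/g\<close>; then \<open>w - t G\<close> has the value
  \<open>(1 - u)/f\<close>. If \<open>f = 0\<close>, then \<open>w - t G\<close> is made to vanish, and if \<open>g = 0\<close>, then \<open>v + t F\<close> is.
\<close>

lemma prufer_local_solution:
  fixes F G :: "'d::idom fract poly"
  assumes D: "prufer_domain (range (to_fract :: 'd \<Rightarrow> 'd fract))" and bezout: "w * F + v * G = 1"
  shows "\<exists>t. ac_eval ((v + t * F) * G) \<alpha> \<in> alg_ints \<and> ac_eval ((v + t * F) * F) \<alpha> \<in> alg_ints \<and>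
    ac_eval ((w - t * G) * G) \<alpha> \<in> alg_ints"
proof -
  note R = is_subringD[OF alg_ints_subring]
  have bez: "ac_eval w \<alpha> * ac_eval F \<alpha> + ac_eval v \<alpha> * ac_eval G \<alpha> = 1"
    using arg_cong[OF bezout, of "\<lambda>p. ac_eval p \<alpha>"] by simp
  consider "ac_eval F \<alpha> = 0" | "ac_eval G \<alpha> = 0" | "ac_eval F \<alpha> \<noteq> 0" "ac_eval G \<alpha> \<noteq> 0" by blast
  then show ?thesis
  proof cases
    case 1
    then have "ac_eval G \<alpha> \<noteq> 0" using bez by auto
    then obtain c where c: "ac_eval c \<alpha> * ac_eval G \<alpha> = 1" by (rule ac_eval_inverse)
    have "ac_eval ((v + w * c * F) * G) \<alpha> = 1" "ac_eval ((v + w * c * F) * F) \<alpha> = 0"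
      "ac_eval ((w - w * c * G) * G) \<alpha> = 0"
      using bez c 1 by (simp_all add: mult.assoc)
    then show ?thesis using R(1,2) by (intro exI[of _ "w * c"]) (simp only: simp_thms)
  next
    case 2
    then have "ac_eval F \<alpha> \<noteq> 0" using bez by auto
    then obtain c where c: "ac_eval c \<alpha> * ac_eval F \<alpha> = 1" by (rule ac_eval_inverse)
    have "ac_eval (v + (- v) * c * F) \<alpha> = ac_eval v \<alpha> - ac_eval v \<alpha> * (ac_eval c \<alpha> * ac_eval F \<alpha>)"
      by simp
    also have "\<dots> = 0" using c by simp
    finally have "ac_eval (v + (- v) * c * F) \<alpha> = 0" .
    then show ?thesis using R(1) 2 by (intro exI[of _ "(- v) * c"]) (simp only: ac_eval_simps mult_zero_left mult_zero_right)
  next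
    case 3
    obtain c where c: "ac_eval c \<alpha> * ac_eval F \<alpha> = 1" using ac_eval_inverse[OF 3(1)] .
    obtain e where e: "ac_eval e \<alpha> * ac_eval G \<alpha> = 1" using ac_eval_inverse[OF 3(2)] .
    define y where "y = ac_eval (F * e) \<alpha>"
    have y: "y = ac_eval e \<alpha> * ac_eval F \<alpha>" by (simp add: y_def)
    obtain U q where U: "ac_eval U y \<in> alg_ints" "ac_eval U y * y \<in> alg_ints"
      "q \<in> alg_ints" "1 - ac_eval U y = y * q" by (rule prufer_pair_in_alg_ints[OF D])
    define p where "p = pcompose U (F * e)"
    define t where "t = (p * e - v) * c"
    have p: "ac_eval p \<alpha> = ac_eval U y" by (simp add: p_def y_def ac_eval_pcompose)
    have "ac_eval (v + t * F) \<alpha> = ac_eval v \<alpha> + (ac_eval U y * ac_eval e \<alpha> - ac_eval v \<alpha>) * (ac_eval c \<alpha> * ac_eval F \<alpha>)"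
      by (simp add: t_def p)
    then have V: "ac_eval (v + t * F) \<alpha> = ac_eval U y * ac_eval e \<alpha>" using c by simp
    have bez': "ac_eval (w - t * G) \<alpha> * ac_eval F \<alpha> + ac_eval (v + t * F) \<alpha> * ac_eval G \<alpha> = 1"
      using bez by (simp add: algebra_simps)
    have "ac_eval ((v + t * F) * G) \<alpha> = ac_eval U y * (ac_eval e \<alpha> * ac_eval G \<alpha>)"
      by (simp only: ac_eval_simps(6) V mult.assoc)
    then have VG: "ac_eval ((v + t * F) * G) \<alpha> = ac_eval U y" using e by simp
    have "ac_eval ((v + t * F) * F) \<alpha> = ac_eval U y * y"
      unfolding ac_eval_simps(6) V y by (simp only: mult.assoc)
    moreover have "ac_eval ((w - t * G) * G) \<alpha> = q"
    proof -
      have "ac_eval (w - t * G) \<alpha> * ac_eval F \<alpha> = y * q"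
        using bez' VG U(4) by (simp only: ac_eval_simps(6)) (metis add_diff_cancel_right')
      then have "ac_eval (w - t * G) \<alpha> * ac_eval F \<alpha> * ac_eval c \<alpha> * ac_eval G \<alpha> =
        y * q * ac_eval c \<alpha> * ac_eval G \<alpha>" by (simp only:)
      also have "\<dots> = (ac_eval c \<alpha> * ac_eval F \<alpha>) * (ac_eval e \<alpha> * ac_eval G \<alpha>) * q"
        by (simp only: y mult_ac)
      finally have "ac_eval (w - t * G) \<alpha> * ac_eval F \<alpha> * ac_eval c \<alpha> * ac_eval G \<alpha> = \<dots>" .
      moreover have "ac_eval (w - t * G) \<alpha> * ac_eval F \<alpha> * ac_eval c \<alpha> * ac_eval G \<alpha> =
        (ac_eval c \<alpha> * ac_eval F \<alpha>) * (ac_eval (w - t * G) \<alpha> * ac_eval G \<alpha>)"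
        by (simp only: mult_ac)
      ultimately show ?thesis using c e by (simp only: ac_eval_simps(6) mult_1_left)
    qed
    ultimately show ?thesis using U VG by (intro exI[of _ t]) metis
  qed
qed

theorem prufer_integral_on:
  fixes Z :: "'d::idom fract alg_closure set"
  assumes D: "prufer_domain (range (to_fract :: 'd \<Rightarrow> 'd fract))" and "finite Z"
  shows "prufer_domain (to_fract ` integral_on Z)"
  unfolding prufer_domain_iff_pairs
proof (intro conjI integral_on_subring ballI)
  fix a b assume ab: "a \<in> to_fract ` integral_on Z - {0}" "b \<in> to_fract ` integral_on Z - {0}"
  obtain F G w v where FG: "a / b = to_fract F / to_fract G" "G \<noteq> 0" "w * F + v * G = 1"
    by (rule poly_fract_reduced)
  have F: "F \<noteq> 0" using FG(1,2) ab by auto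
  define Q where "Q \<alpha> \<tau> \<longleftrightarrow>
    (ac_eval v \<alpha> + \<tau> * ac_eval F \<alpha>) * ac_eval G \<alpha> \<in> alg_ints \<and>
    (ac_eval v \<alpha> + \<tau> * ac_eval F \<alpha>) * ac_eval F \<alpha> \<in> alg_ints \<and>
    (ac_eval w \<alpha> - \<tau> * ac_eval G \<alpha>) * ac_eval G \<alpha> \<in> alg_ints" for \<alpha> \<tau>
  have Q: "Q \<alpha> (ac_eval t \<alpha>) \<longleftrightarrow> ac_eval ((v + t * F) * G) \<alpha> \<in> alg_ints \<and>
    ac_eval ((v + t * F) * F) \<alpha> \<in> alg_ints \<and> ac_eval ((w - t * G) * G) \<alpha> \<in> alg_ints" for \<alpha> t
    by (simp only: Q_def ac_eval_simps)
  have "\<exists>t. \<forall>\<alpha>\<in>Z. Q \<alpha> (ac_eval t \<alpha>)"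
  proof (rule ac_eval_interpolation[OF \<open>finite Z\<close>])
    show "\<exists>t. Q \<alpha> (ac_eval t \<alpha>)" for \<alpha>
      unfolding Q by (rule prufer_local_solution[OF D FG(3)])
    show "specializes \<alpha> \<beta> \<Longrightarrow> Q \<alpha> (ac_eval t \<alpha>) \<Longrightarrow> Q \<beta> (ac_eval t \<beta>)" for \<alpha> \<beta> t
      unfolding Q using specializes_alg_ints by blast
  qed
  then obtain t where t: "\<forall>\<alpha>\<in>Z. Q \<alpha> (ac_eval t \<alpha>)" by blast
  have mem: "(v + t * F) * G \<in> integral_on Z" "(v + t * F) * F \<in> integral_on Z" "(w - t * G) * G \<in> integral_on Z"
    using t unfolding Q integral_on_def by auto
  define u where "u = to_fract ((v + t * F) * G)"
  have "u \<in> to_fract ` integral_on Z" using mem(1) unfolding u_def by (rule imageI)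
  moreover have "u * a / b = to_fract ((v + t * F) * F)"
  proof -
    have "u * a / b = u * (to_fract F / to_fract G)" using FG(1) by (metis times_divide_eq_right)
    then show ?thesis using FG(2) by (simp add: u_def)
  qed
  moreover have "(1 - u) * b / a = to_fract ((w - t * G) * G)"
  proof -
    have "1 - (v + t * F) * G = (w - t * G) * F" using FG(3) by (simp add: algebra_simps)
    then have "1 - u = to_fract ((w - t * G) * F)"
      unfolding u_def by (metis to_fract_1 to_fract_diff)
    moreover have "b / a = to_fract G / to_fract F"
      using arg_cong[OF FG(1), of inverse] by simp
    ultimately have "(1 - u) * b / a = to_fract ((w - t * G) * F) * (to_fract G / to_fract F)"
      by (metis times_divide_eq_right)
    then show ?thesis using F by simp
  qed
  ultimately show "\<exists>u\<in>to_fract ` integral_on Z. u * a / b \<in> to_fract ` integral_on Z \<and> (1 - u) * b / a \<in> to_fract ` integral_on Z"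
    using mem(2,3) by (intro bexI[of _ u] conjI) (simp_all only: imageI)
qed

text \<open>
  The element \<open>r * x\<close> is integral, since \<open>(r x)^(k+1) = r^k (r x^(k+1))\<close> is in \<open>D\<close>.
\<close>

lemma integrally_closed_scaled_root:
  assumes "integrally_closed_domain TYPE('d::idom)"
    and "r \<in> range (to_fract :: 'd \<Rightarrow> 'd fract)" "r * x ^ Suc k \<in> range to_fract"
  shows "r * x \<in> range to_fract"
proof -
  define c where "c i = (if i = 0 then - to_ac (r ^ k * (r * x ^ Suc k)) else 0)" for i :: nat
  have "to_ac (r * x) ^ Suc k + (\<Sum>i<Suc k. c i * to_ac (r * x) ^ i) = 0"
    by (simp add: c_def power_mult_distrib if_distrib[of "\<lambda>c. c * _"] cong: if_cong)
  moreover have "r ^ k * (r * x ^ Suc k) \<in> range to_fract"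
    by (intro is_subringD(5)[OF range_to_fract_subring] is_subring_power[OF range_to_fract_subring] assms(2,3))
  then have "- to_ac (r ^ k * (r * x ^ Suc k)) \<in> alg_ints"
    using to_ac_in_alg_ints_iff[OF assms(1)] is_subringD(3)[OF alg_ints_subring] by blast
  then have "c i \<in> alg_ints" for i
    by (simp add: c_def del: to_ac_mult to_ac_power to_ac_minus)
  ultimately have "to_ac (r * x) \<in> alg_ints" by (rule alg_ints_monic_root[rotated])
  then show ?thesis using to_ac_in_alg_ints_iff[OF assms(1)] by blast
qed

text \<open>
  The polynomial with coefficients \<open>m_i * z^(n-i)\<close> has the roots \<open>z * u\<close>, and its coefficients are
  polynomial expressions in them.
\<close>

lemma coeff_prod_linear_integral:
  assumes "\<And>u. u \<in> set us \<Longrightarrow> z * u \<in> alg_ints"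
  shows "coeff (\<Prod>u\<leftarrow>us. [:- u, 1:]) i * z ^ (length us - i) \<in> alg_ints"
  using assms
proof (induction us arbitrary: i)
  case Nil
  then show ?case by (simp add: coeff_1)
next
  case (Cons u us)
  note R = is_subringD[OF alg_ints_subring]
  define P where "P = (\<Prod>u\<leftarrow>us. [:- u, 1:])"
  have IH: "coeff P i * z ^ (length us - i) \<in> alg_ints" for i
    unfolding P_def using Cons by simp
  have deg: "degree P \<le> length us"
    unfolding P_def
  proof (induction us)
    case (Cons v vs)
    then show ?case
      using degree_mult_le[of "[:- v, 1:]" "\<Prod>u\<leftarrow>vs. [:- u, 1:]"] by (simp del: mult_pCons_left)
  qed simp
  have co: "coeff (\<Prod>u\<leftarrow>u # us. [:- u, 1:]) i = - u * coeff P i + (if i = 0 then 0 else coeff P (i - 1))"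
    by (cases i) (simp_all add: P_def)
  have 1: "- u * coeff P i * z ^ (length (u # us) - i) \<in> alg_ints"
  proof (cases "i \<le> length us")
    case True
    then have "- u * coeff P i * z ^ (length (u # us) - i) = - ((z * u) * (coeff P i * z ^ (length us - i)))"
      by (simp add: Suc_diff_le mult_ac)
    moreover have "- ((z * u) * (coeff P i * z ^ (length us - i))) \<in> alg_ints"
      by (intro R(3,5) IH Cons.prems) simp
    ultimately show ?thesis by (simp only:)
  next
    case False
    then have "coeff P i = 0" by (intro coeff_eq_0) (use deg in simp)
    then show ?thesis by simp
  qed
  have 2: "(if i = 0 then 0 else coeff P (i - 1)) * z ^ (length (u # us) - i) \<in> alg_ints"
    using IH[of "i - 1"] by (cases i) auto
  show ?case unfolding co distrib_right using 1 2 R(4) by blast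
qed

theorem prufer_base_domain:
  fixes Z :: "'d::idom fract alg_closure set"
  assumes icd: "integrally_closed_domain TYPE('d)" and "Z \<noteq> {}"
    and C: "prufer_domain (to_fract ` integral_on Z)"
  shows "prufer_domain (range (to_fract :: 'd \<Rightarrow> 'd fract))"
  unfolding prufer_domain_iff_pairs
proof (intro conjI range_to_fract_subring ballI)
  note R = is_subringD[OF alg_ints_subring]
  let ?D = "range (to_fract :: 'd \<Rightarrow> 'd fract)"
  note D = is_subringD[OF range_to_fract_subring[where ?'a = 'd]]
  fix a b assume ab: "a \<in> ?D - {0}" "b \<in> ?D - {0}"
  define x where "x = a / b"
  have xnz: "x \<noteq> 0" using ab by (auto simp: x_def)
  have "[:a:] \<in> integral_on Z" "[:b:] \<in> integral_on Z" using ab by (auto simp: integral_on_def)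
  then have "to_fract [:a:] \<in> to_fract ` integral_on Z - {0}" "to_fract [:b:] \<in> to_fract ` integral_on Z - {0}"
    using ab by auto
  then obtain U where U: "U \<in> to_fract ` integral_on Z"
     "U * to_fract [:a:] / to_fract [:b:] \<in> to_fract ` integral_on Z"
     "(1 - U) * to_fract [:b:] / to_fract [:a:] \<in> to_fract ` integral_on Z"
    using C unfolding prufer_domain_iff_pairs by blast
  obtain F where F: "U = to_fract F" "F \<in> integral_on Z" using U(1) by blast
  obtain H where H: "U * to_fract [:a:] / to_fract [:b:] = to_fract H" "H \<in> integral_on Z" using U(2) by blast
  obtain H' where H': "(1 - U) * to_fract [:b:] / to_fract [:a:] = to_fract H'" "H' \<in> integral_on Z" using U(3) by blast
  have "to_fract (F * [:a:]) = to_fract (H * [:b:])"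
    using H(1) ab unfolding F(1) by (simp only: to_fract_mult) (simp add: field_simps)
  then have FH: "F * [:a:] = H * [:b:]" by (simp only: to_fract_eq_iff)
  have "to_fract ((1 - F) * [:b:]) = to_fract (H' * [:a:])"
    using H'(1) ab unfolding F(1) by (simp only: to_fract_mult to_fract_diff to_fract_1) (simp add: field_simps)
  then have FH': "(1 - F) * [:b:] = H' * [:a:]" by (simp only: to_fract_eq_iff)
  obtain \<alpha> where \<alpha>: "\<alpha> \<in> Z" using \<open>Z \<noteq> {}\<close> by blast
  define u where "u = ac_eval F \<alpha>"
  have "u * to_ac a = ac_eval H \<alpha> * to_ac b"
    using arg_cong[OF FH, of "\<lambda>p. ac_eval p \<alpha>"] by (simp only: ac_eval_simps u_def) simp
  then have ux: "ac_eval H \<alpha> = to_ac x * u" using ab by (simp add: x_def field_simps)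
  have "(1 - u) * to_ac b = ac_eval H' \<alpha> * to_ac a"
    using arg_cong[OF FH', of "\<lambda>p. ac_eval p \<alpha>"] by (simp only: ac_eval_simps u_def) simp
  then have u1: "ac_eval H' \<alpha> = (1 - u) / to_ac x" using ab by (simp add: x_def field_simps)
  have uints: "u \<in> alg_ints" "to_ac x * u \<in> alg_ints" "(1 - u) / to_ac x \<in> alg_ints"
    using F(2) H(2) H'(2) \<alpha> unfolding ux[symmetric] u1[symmetric] by (auto simp: integral_on_def u_def)
  have conj: "u' \<in> alg_ints" "to_ac x * u' \<in> alg_ints" "(1 - u') / to_ac x \<in> alg_ints"
    if "specializes u u'" for u'
    using specializes_alg_ints[OF that, of "[:0, 1:]"] specializes_alg_ints[OF that, of "[:0, x:]"]
      specializes_alg_ints[OF that, of "[:1 / x, - 1 / x:]"] uints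
    by (simp_all add: mult.commute diff_divide_distrib)
  have "\<exists>\<pi>\<in>{h. ac_eval h u = 0}. \<forall>h\<in>{h. ac_eval h u = 0}. \<pi> dvd h"
    by (rule poly_ideal_principal) auto
  then obtain \<pi>' where \<pi>': "ac_eval \<pi>' u = 0" "\<And>h. ac_eval h u = 0 \<Longrightarrow> \<pi>' dvd h" by auto
  obtain p where "p \<noteq> 0" "ac_eval p u = 0" unfolding ac_eval_def by (rule alg_closure_algebraic)
  then have nz: "\<pi>' \<noteq> 0" using \<pi>'(2) by auto
  \<comment> \<open>The minimal polynomial of \<open>u\<close>; its roots are the conjugates of \<open>u\<close>.\<close>
  define \<pi> where "\<pi> = smult (inverse (lead_coeff \<pi>')) \<pi>'"
  have monic: "lead_coeff \<pi> = 1" and \<pi>u: "ac_eval \<pi> u = 0" using nz \<pi>'(1) by (simp_all add: \<pi>_def)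
  have \<pi>: "\<pi> dvd h" if "ac_eval h u = 0" for h
    using \<pi>'(2)[OF that] nz unfolding \<pi>_def by (intro smult_dvd) auto
  have spec: "specializes u u'" if "ac_eval \<pi> u' = 0" for u'
    unfolding specializes_def
  proof (intro allI impI)
    fix h assume "ac_eval h u = 0"
    then obtain k where "h = \<pi> * k" using \<pi> by (metis dvdE)
    then show "ac_eval h u' = 0" using that by simp
  qed
  have deg: "degree (map_poly to_ac \<pi>) = degree \<pi>"
    using monic by (intro map_poly_degree_eq) simp
  have lc: "lead_coeff (map_poly to_ac \<pi>) = 1" using monic by (simp add: deg)
  then have "map_poly to_ac \<pi> \<noteq> 0" by auto
  from alg_closed_imp_factorization[OF this] lc
  obtain A where A: "size A = degree \<pi>" "map_poly to_ac \<pi> = (\<Prod>u\<in>#A. [:- u, 1:])"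
    by (auto simp: deg)
  obtain us where us: "mset us = A" using ex_mset by blast
  define N where "N = length us"
  have N: "degree \<pi> = N" using A(1) us by (auto simp: N_def)
  have prod: "map_poly to_ac \<pi> = (\<Prod>u\<leftarrow>us. [:- u, 1:])"
    unfolding A(2) us[symmetric] by (simp flip: prod_mset_prod_list mset_map)
  have roots: "ac_eval \<pi> u' = 0" if "u' \<in> set us" for u'
    unfolding ac_eval_def prod poly_prod_list using that by (auto simp: prod_list_zero_iff image_iff)
  have "N \<noteq> 0"
  proof
    assume "N = 0"
    then have "\<pi> = 1" using monic N by (metis monic_degree_0 )
    then show False using \<pi>u by simp
  qed
  have coeffx: "coeff \<pi> i * x ^ (N - i) \<in> ?D" for i
  proof -
    have "coeff (map_poly to_ac \<pi>) i * to_ac x ^ (N - i) \<in> alg_ints"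
      unfolding prod N_def using conj(2) spec roots by (intro coeff_prod_linear_integral) blast
    then have "to_ac (coeff \<pi> i * x ^ (N - i)) \<in> alg_ints" by simp
    then show ?thesis using to_ac_in_alg_ints_iff[OF icd] by blast
  qed
  have coeff1: "coeff \<pi> i \<in> ?D" for i
  proof -
    have "coeff (map_poly to_ac \<pi>) i * 1 ^ (N - i) \<in> alg_ints"
      unfolding prod N_def using conj(1) spec roots by (intro coeff_prod_linear_integral) simp
    then have "to_ac (coeff \<pi> i) \<in> alg_ints" by simp
    then show ?thesis using to_ac_in_alg_ints_iff[OF icd] by blast
  qed
  have mx: "coeff \<pi> i * x \<in> ?D" if "i < N" for i
  proof (rule integrally_closed_scaled_root[OF icd coeff1])
    have "Suc (N - i - 1) = N - i" using that by simp
    then show "coeff \<pi> i * x ^ Suc (N - i - 1) \<in> ?D" using coeffx[of i] by (simp only:)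
  qed
  define r where "r = poly \<pi> 1"
  have r: "r = (\<Sum>i<N. coeff \<pi> i) + 1"
    using monic by (simp add: r_def poly_altdef N lessThan_Suc_atMost[symmetric])
  \<comment> \<open>\<open>r = m(1)\<close> is the product of the \<open>1 - u\<close> over all conjugates, so \<open>r / x^N\<close> is a product of integral elements.\<close>
  have "to_ac r / to_ac x ^ N = (\<Prod>u\<leftarrow>us. (1 - u) / to_ac x)"
  proof -
    have "to_ac r = (\<Prod>u\<leftarrow>us. 1 - u)"
      using arg_cong[OF prod, of "\<lambda>p. poly p (to_ac 1)"]
      unfolding r_def to_ac.base.poly_map_poly poly_prod_list by (simp add: o_def)
    moreover have "(\<Prod>u\<leftarrow>vs. 1 - u) / z ^ length vs = (\<Prod>u\<leftarrow>vs. (1 - u) / z)"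
      for z :: "'d fract alg_closure" and vs
      by (induction vs) (simp_all only: list.map prod_list.Cons prod_list.Nil length_Cons power_Suc
        list.size power_0 div_by_1 flip: times_divide_times_eq)
    ultimately show ?thesis unfolding N_def by (simp only:)
  qed
  also have "\<dots> \<in> alg_ints"
  proof -
    have "prod_list vs \<in> alg_ints" if "set vs \<subseteq> alg_ints" for vs :: "'d fract alg_closure list"
      using that by (induction vs) (auto intro: R)
    then show ?thesis using conj(3) spec roots by (metis (no_types, lifting) image_subset_iff set_map)
  qed
  finally have "to_ac (r * (1 / x) ^ N) \<in> alg_ints" by (simp add: power_inverse divide_inverse)
  then have "r * (1 / x) ^ N \<in> ?D" by (simp only: to_ac_in_alg_ints_iff[OF icd])
  then have rx: "r * (1 / x) ^ Suc (N - 1) \<in> ?D" using \<open>N \<noteq> 0\<close> by simp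
  have rD: "r \<in> ?D"
    unfolding r using coeff1 by (intro D(2,4) is_subring_sum[OF range_to_fract_subring])
  have "r * (1 / x) \<in> ?D" using integrally_closed_scaled_root[OF icd rD rx] .
  moreover have "(1 - r) * x = - (\<Sum>i<N. coeff \<pi> i * x)" by (simp add: r sum_distrib_right)
  moreover have "- (\<Sum>i<N. coeff \<pi> i * x) \<in> ?D"
    by (rule D(3), rule is_subring_sum[OF range_to_fract_subring], rule mx) simp
  ultimately show "\<exists>u\<in>?D. u * a / b \<in> ?D \<and> (1 - u) * b / a \<in> ?D"
    using D(6)[OF D(2) rD] by (intro bexI[of _ "1 - r"]) (simp_all add: x_def)
qed

section \<open>The integral closure in terms of values at the roots\<close>

lemma dvd_if_dvd_map_to_ac:
  assumes "\<mu> \<noteq> 0" "map_poly to_ac \<mu> dvd map_poly to_ac q"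
  shows "\<mu> dvd q"
proof (rule ccontr)
  assume "\<not> \<mu> dvd q"
  then have nz: "q mod \<mu> \<noteq> 0" by auto
  have deg: "degree (map_poly to_ac f) = degree f" if "f \<noteq> 0" for f
    using that by (intro map_poly_degree_eq) simp
  have "q mod \<mu> = q - \<mu> * (q div \<mu>)" by (simp add: minus_mult_div_eq_mod)
  then have "map_poly to_ac (q mod \<mu>) = map_poly to_ac q - map_poly to_ac \<mu> * map_poly to_ac (q div \<mu>)"
    by (simp add: hom_distribs)
  then have "map_poly to_ac \<mu> dvd map_poly to_ac (q mod \<mu>)" using assms(2) by simp
  moreover have "map_poly to_ac (q mod \<mu>) \<noteq> 0"
  proof
    assume "map_poly to_ac (q mod \<mu>) = 0"
    then have "coeff (map_poly to_ac (q mod \<mu>)) i = 0" for i by simp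
    then have "coeff (q mod \<mu>) i = 0" for i by simp
    then show False using nz by (meson leading_coeff_0_iff)
  qed
  ultimately have "degree \<mu> \<le> degree (q mod \<mu>)"
    using dvd_imp_degree_le deg nz assms(1) by metis
  then show False using degree_mod_less[OF assms(1), of q] nz by simp
qed

lemma alg_ints_annihilator:
  assumes "y \<in> (alg_ints :: 'd::idom fract alg_closure set)"
  shows "\<exists>p. lead_coeff p = 1 \<and> (\<forall>i. coeff p i \<in> range (to_fract :: 'd \<Rightarrow> 'd fract)) \<and> ac_eval p y = 0"
proof -
  obtain n and d :: "nat \<Rightarrow> 'd" where d: "y ^ n + (\<Sum>i<n. to_ac (to_fract (d i)) * y ^ i) = 0"
    using assms by (rule alg_intsE)
  define p where "p = monom 1 n + (\<Sum>i<n. monom (to_fract (d i)) i)"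
  have co: "coeff p j = (if j = n then 1 else if j < n then to_fract (d j) else 0)" for j
    by (auto simp: p_def coeff_sum)
  have "degree p = n"
    by (intro antisym degree_le le_degree) (auto simp: co)
  then have "lead_coeff p = 1" by (simp add: co)
  moreover have "ac_eval (monom c i) y = to_ac c * y ^ i" for c :: "'d fract" and i
    by (simp add: ac_eval_def poly_monom)
  then have "ac_eval p y = 0" using d by (simp add: p_def ac_eval_sum)
  moreover have "\<forall>i. coeff p i \<in> range (to_fract :: 'd \<Rightarrow> 'd fract)"
    using is_subringD(1,2)[OF range_to_fract_subring[where ?'a = 'd]] by (simp add: co)
  ultimately show ?thesis by blast
qed

text \<open>
  The hypotheses say \<open>D + \<mu> K[X] \<subseteq> I \<subseteq> C\<close>; every set between these two has the integral closure \<open>C\<close>.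
  For \<open>C\<close> inside the integral closure, multiply annihilators of the values of \<open>f\<close> at the roots of
  \<open>\<mu>\<close>, with multiplicity, to a monic \<open>P\<close> over \<open>D\<close> with \<open>P(f) = \<mu> h\<close>.
\<close>

lemma integral_closure_eq_integral_on:
  fixes I :: "'d::idom fract poly set"
  assumes \<mu>: "\<mu> \<noteq> 0" and sub: "I \<subseteq> integral_on {\<alpha>. ac_eval \<mu> \<alpha> = 0}"
    and mem: "\<And>d h. [:to_fract d:] + \<mu> * h \<in> I"
  shows "integral_closure (to_fract ` I) = to_fract ` integral_on {\<alpha>. ac_eval \<mu> \<alpha> = 0}"
proof (intro equalityI subsetI)
  let ?Z = "{\<alpha>. ac_eval \<mu> \<alpha> = 0}"
  fix x assume "x \<in> integral_closure (to_fract ` I)"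
  then have "integral_over (to_fract ` integral_on ?Z) x"
    using sub unfolding integral_closure_def integral_over_def by blast
  then obtain n c where c: "\<forall>i<n. c i \<in> to_fract ` integral_on ?Z" "x ^ n + (\<Sum>i<n. c i * x ^ i) = 0"
    unfolding integral_over_iff[OF integral_on_subring] by blast
  from c(1) have "\<forall>i\<in>{..<n}. \<exists>r. r \<in> integral_on ?Z \<and> c i = to_fract r" by blast
  then obtain r where r: "\<And>i. i < n \<Longrightarrow> r i \<in> integral_on ?Z" "\<And>i. i < n \<Longrightarrow> c i = to_fract (r i)"
    by (metis lessThan_iff)
  have "integral_over (range to_fract) x"
    unfolding integral_over_iff[OF range_to_fract_subring] using c by blast
  then obtain f where f: "x = to_fract f" using poly_integrally_closed by blast
  have "(\<Sum>i<n. c i * x ^ i) = (\<Sum>i<n. to_fract (r i * f ^ i))"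
    by (intro sum.cong refl) (simp add: r(2) f to_fract_power)
  then have "to_fract (f ^ n + (\<Sum>i<n. r i * f ^ i)) = 0"
    using c(2) by (simp add: f to_fract_power)
  then have rel: "f ^ n + (\<Sum>i<n. r i * f ^ i) = 0" by (simp only: to_fract_eq_0_iff)
  have "ac_eval f \<alpha> \<in> alg_ints" if "\<alpha> \<in> ?Z" for \<alpha>
  proof (rule alg_ints_monic_root)
    show "ac_eval (r i) \<alpha> \<in> alg_ints" if "i < n" for i
      using r(1)[OF that] \<open>\<alpha> \<in> ?Z\<close> by (simp add: integral_on_def)
    show "ac_eval f \<alpha> ^ n + (\<Sum>i<n. ac_eval (r i) \<alpha> * ac_eval f \<alpha> ^ i) = 0"
      using arg_cong[OF rel, of "\<lambda>p. ac_eval p \<alpha>"] by (simp add: ac_eval_sum)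
  qed
  then show "x \<in> to_fract ` integral_on ?Z" unfolding f integral_on_def by blast
next
  let ?Z = "{\<alpha>. ac_eval \<mu> \<alpha> = 0}"
  let ?D = "range (to_fract :: 'd \<Rightarrow> 'd fract)"
  fix x assume "x \<in> to_fract ` integral_on ?Z"
  then obtain f where f: "x = to_fract f" "f \<in> integral_on ?Z" by blast
  have "map_poly to_ac \<mu> \<noteq> 0"
  proof
    assume "map_poly to_ac \<mu> = 0"
    then have "coeff (map_poly to_ac \<mu>) i = 0" for i by simp
    then have "coeff \<mu> i = 0" for i by simp
    then show False using \<mu> by (meson leading_coeff_0_iff)
  qed
  from alg_closed_imp_factorization[OF this] obtain A
    where A: "map_poly to_ac \<mu> = smult (lead_coeff (map_poly to_ac \<mu>)) (\<Prod>\<alpha>\<in>#A. [:- \<alpha>, 1:])" by blast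
  obtain as where as: "mset as = A" using ex_mset by blast
  define l where "l = lead_coeff (map_poly to_ac \<mu>)"
  have prod: "map_poly to_ac \<mu> = smult l (\<Prod>\<alpha>\<leftarrow>as. [:- \<alpha>, 1:])"
    unfolding l_def using A unfolding as[symmetric] by (simp flip: prod_mset_prod_list mset_map)
  have roots: "\<alpha> \<in> ?Z" if "\<alpha> \<in> set as" for \<alpha>
  proof -
    have "ac_eval \<mu> \<alpha> = 0"
      unfolding ac_eval_def prod poly_smult poly_prod_list
      using that by (auto simp: prod_list_zero_iff image_iff)
    then show ?thesis by simp
  qed
  have "\<exists>p. lead_coeff p = 1 \<and> (\<forall>i. coeff p i \<in> ?D) \<and> ac_eval p (ac_eval f \<alpha>) = 0" if "\<alpha> \<in> set as" for \<alpha>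
    using roots[OF that] f(2) by (intro alg_ints_annihilator) (auto simp: integral_on_def)
  then obtain p where p: "\<And>\<alpha>. \<alpha> \<in> set as \<Longrightarrow> lead_coeff (p \<alpha>) = 1"
    "\<And>\<alpha>. \<alpha> \<in> set as \<Longrightarrow> \<forall>i. coeff (p \<alpha>) i \<in> ?D"
    "\<And>\<alpha>. \<alpha> \<in> set as \<Longrightarrow> ac_eval (p \<alpha>) (ac_eval f \<alpha>) = 0" by metis
  define P where "P = (\<Prod>\<alpha>\<leftarrow>as. p \<alpha>)"
  have "lead_coeff P = 1 \<and> (\<forall>i. coeff P i \<in> ?D) \<and>
    (\<Prod>\<alpha>\<leftarrow>as. [:- \<alpha>, 1:]) dvd map_poly to_ac (pcompose P f)"
    unfolding P_def using p
  proof (induction as)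
    case Nil
    then show ?case using is_subringD(1,2)[OF range_to_fract_subring[where ?'a = 'd]]
      by (auto simp: coeff_1)
  next
    case (Cons \<alpha> as)
    define q where "q = (\<Prod>\<alpha>\<leftarrow>as. p \<alpha>)"
    have IH: "lead_coeff q = 1 \<and> (\<forall>i. coeff q i \<in> ?D) \<and>
      (\<Prod>\<alpha>\<leftarrow>as. [:- \<alpha>, 1:]) dvd map_poly to_ac (pcompose q f)"
      unfolding q_def by (rule Cons.IH) (use Cons.prems in auto)
    have "ac_eval (pcompose (p \<alpha>) f) \<alpha> = 0" using Cons.prems(3) by (simp add: ac_eval_pcompose)
    then have "[:- \<alpha>, 1:] dvd map_poly to_ac (pcompose (p \<alpha>) f)"
      unfolding ac_eval_def by (simp only: poly_eq_0_iff_dvd)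
    then have "[:- \<alpha>, 1:] * (\<Prod>\<alpha>\<leftarrow>as. [:- \<alpha>, 1:]) dvd
      map_poly to_ac (pcompose (p \<alpha>) f) * map_poly to_ac (pcompose q f)"
      using IH by (intro mult_dvd_mono) auto
    also have "\<dots> = map_poly to_ac (pcompose (p \<alpha> * q) f)"
      by (simp add: pcompose_mult hom_distribs)
    finally have "[:- \<alpha>, 1:] * (\<Prod>\<alpha>\<leftarrow>as. [:- \<alpha>, 1:]) dvd map_poly to_ac (pcompose (p \<alpha> * q) f)" .
    moreover have "lead_coeff (p \<alpha> * q) = 1"
      using IH Cons.prems(1)[of \<alpha>] by (simp add: lead_coeff_mult)
    moreover have "\<forall>i. coeff (p \<alpha> * q) i \<in> ?D"
      using IH Cons.prems(2)[of \<alpha>] by (intro is_subring_coeff_mult[OF range_to_fract_subring]) auto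
    ultimately show ?case by (simp only: list.map prod_list.Cons q_def) blast
  qed
  then have P: "lead_coeff P = 1" "\<And>i. coeff P i \<in> ?D"
    "(\<Prod>\<alpha>\<leftarrow>as. [:- \<alpha>, 1:]) dvd map_poly to_ac (pcompose P f)" by auto
  have "l \<noteq> 0" using prod \<open>map_poly to_ac \<mu> \<noteq> 0\<close> by auto
  then have "map_poly to_ac \<mu> dvd map_poly to_ac (pcompose P f)"
    unfolding prod using P(3) by (simp add: smult_dvd_iff)
  then have "\<mu> dvd pcompose P f" by (rule dvd_if_dvd_map_to_ac[OF \<mu>])
  then obtain h where h: "pcompose P f = \<mu> * h" by (rule dvdE)
  \<comment> \<open>The equation is \<open>X P(X) - \<mu> f h\<close> rather than \<open>P(X) - \<mu> h\<close>: the extra factor \<open>X\<close> keeps the leading coefficient \<open>1\<close> when \<open>P = 1\<close>.\<close>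
  define T where "T = pCons 0 P"
  define E where "E = map_poly (\<lambda>c. to_fract [:c:]) T - [:to_fract (\<mu> * (f * h)):]"
  have Pnz: "P \<noteq> 0" using P(1) by auto
  have coE: "coeff E i = to_fract ([:coeff T i:] + \<mu> * (if i = 0 then - (f * h) else 0))" for i
    by (simp add: E_def coeff_map_poly coeff_pCons split: nat.splits)
  have "degree E \<le> degree T"
    by (rule degree_le) (simp add: coE coeff_eq_0)
  moreover have "coeff E (degree T) \<noteq> 0"
    using P(1) Pnz by (simp add: coE T_def)
  then have "degree T \<le> degree E" by (rule le_degree)
  ultimately have "degree E = degree T" by (rule antisym)
  then have "lead_coeff E = 1" using P(1) Pnz by (simp add: coE T_def one_pCons[symmetric])
  moreover have "coeff E i \<in> to_fract ` I" for i
  proof -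
    have "coeff T i \<in> ?D"
      using P(2) is_subringD(1)[OF range_to_fract_subring[where ?'a = 'd]]
      by (auto simp: T_def coeff_pCons split: nat.splits)
    then obtain d where "coeff T i = to_fract d" by (rule rangeE)
    then show ?thesis unfolding coE by (simp only: mem imageI)
  qed
  moreover have "poly E x = 0"
  proof -
    have "poly (map_poly (\<lambda>c. to_fract [:c:]) q) (to_fract f) = to_fract (pcompose q f)" for q
      by (induction q) (simp_all add: map_poly_pCons pcompose_pCons)
    then show ?thesis by (simp add: E_def f T_def pcompose_pCons h mult_ac)
  qed
  ultimately show "x \<in> integral_closure (to_fract ` I)"
    unfolding integral_closure_def integral_over_def by blast
qed

section \<open>Evaluation of polynomials in an algebra\<close>

definition alg_eval :: "('d::comm_ring_1 \<Rightarrow> 'a::ring_1 \<Rightarrow> 'a) \<Rightarrow> 'd poly \<Rightarrow> 'a \<Rightarrow> 'a" where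
  "alg_eval scale p s = (\<Sum>i\<le>degree p. scale (coeff p i) (s ^ i))"

context unital_algebra
begin

lemma alg_eval_bound:
  assumes "degree p \<le> N"
  shows "alg_eval scale p s = (\<Sum>i\<le>N. scale (coeff p i) (s ^ i))"
  unfolding alg_eval_def using assms
  by (intro sum.mono_neutral_left) (auto simp: coeff_eq_0)

lemma alg_eval_0 [simp]: "alg_eval scale 0 s = 0"
  by (simp add: alg_eval_def)

lemma alg_eval_pCons [simp]: "alg_eval scale (pCons c p) s = scale c 1 + s * alg_eval scale p s"
proof -
  have "alg_eval scale (pCons c p) s = (\<Sum>i\<le>Suc (degree p). scale (coeff (pCons c p) i) (s ^ i))"
    by (rule alg_eval_bound) (rule degree_pCons_le)
  also have "\<dots> = scale c 1 + (\<Sum>i\<le>degree p. scale (coeff p i) (s ^ Suc i))"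
    by (subst sum.atMost_Suc_shift) simp
  finally show ?thesis by (simp add: alg_eval_def sum_distrib_left scale_mult_right)
qed

lemma alg_eval_add [simp]: "alg_eval scale (p + q) s = alg_eval scale p s + alg_eval scale q s"
proof -
  define N where "N = max (degree p) (degree q)"
  have "degree (p + q) \<le> N" unfolding N_def by (rule degree_add_le_max)
  then show ?thesis
    by (simp add: alg_eval_bound[of _ N] N_def scale_left_distrib sum.distrib)
qed

lemma alg_eval_smult [simp]: "alg_eval scale (smult c p) s = scale c (alg_eval scale p s)"
  by (induction p) (simp_all add: scale_right_distrib scale_mult_right)

lemma alg_eval_mult [simp]: "alg_eval scale (p * q) s = alg_eval scale p s * alg_eval scale q s"
  by (induction p) (simp_all add: scale_mult_left[symmetric] distrib_right mult.assoc)

lemma alg_eval_1 [simp]: "alg_eval scale 1 s = 1"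
  by (simp add: alg_eval_def)

lemma alg_eval_prod_eq_0:
  assumes "finite T" "t \<in> T" "alg_eval scale (p t) s = 0"
  shows "alg_eval scale (prod p T) s = 0"
  using assms by (simp add: prod.remove)

text \<open>
  The determinant trick again. Left multiplication by \<open>a\<close> commutes with the scalars, so polynomials
  over \<open>D\<close> act on the algebra through their value at \<open>a\<close>, commutative or not.
\<close>

lemma finitely_generated_integral:
  assumes "finitely_generated_module scale"
  obtains p where "lead_coeff p = 1" "alg_eval scale p a = 0"
proof -
  obtain G where G: "finite G" "span G = UNIV"
    using assms unfolding finitely_generated_module_def by blast
  define n where "n = card G"
  obtain v where v: "bij_betw v {..<n} G"
    using ex_bij_betw_nat_finite[OF G(1)] by (auto simp: atLeast0LessThan n_def)
  have "\<forall>h. \<exists>c. a * h = (\<Sum>g\<in>G. scale (c g) g)"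
  proof
    fix h
    have "a * h \<in> span G" by (simp add: G(2))
    then show "\<exists>c. a * h = (\<Sum>g\<in>G. scale (c g) g)" unfolding span_finite[OF G(1)] by blast
  qed
  then obtain c where c: "\<And>h. a * h = (\<Sum>g\<in>G. scale (c h g) g)" by metis
  define M where "M = mat n n (\<lambda>(j, k). c (v j) (v k))"
  have M: "M \<in> carrier_mat n n" by (simp add: M_def)
  define N where "N = char_poly_matrix M"
  have N: "N \<in> carrier_mat n n" using M by (simp add: N_def)
  have entry: "N $$ (j, k) = (if j = k then [:0, 1:] else 0) + [:- c (v j) (v k):]"
    if "j < n" "k < n" for j k
    using that by (simp add: N_def char_poly_matrix_def M_def)
  have module: "Modules.module (\<lambda>p y. alg_eval scale p a * y)"
    by unfold_locales (auto simp: algebra_simps)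
  have av: "a * v j = (\<Sum>k<n. scale (c (v j) (v k)) (v k))" for j
    using c[of "v j"] sum.reindex_bij_betw[OF v, of "\<lambda>g. scale (c (v j) g) g"] by simp
  have ker: "(\<Sum>k<n. alg_eval scale (N $$ (j, k)) a * v k) = 0" if "j < n" for j
  proof -
    have "(\<Sum>k<n. alg_eval scale (N $$ (j, k)) a * v k) =
      (\<Sum>k<n. (if k = j then a * v j else 0) - scale (c (v j) (v k)) (v k))"
      using that by (intro sum.cong) (auto simp: entry algebra_simps scale_mult_left[symmetric])
    also have "\<dots> = 0" using that av[of j] by (simp add: sum_subtractf)
    finally show ?thesis .
  qed
  have zero: "alg_eval scale (char_poly M) a * g = 0" if "g \<in> G" for g
  proof -
    obtain i where i: "i < n" "v i = g" using v \<open>g \<in> G\<close> by (auto simp: bij_betw_def)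
    show ?thesis using det_annihilates[OF module N ker i(1)] unfolding i(2) by (simp add: char_poly_def N_def)
  qed
  have "1 \<in> span G" by (simp add: G(2))
  then obtain u where u: "1 = (\<Sum>g\<in>G. scale (u g) g)" unfolding span_finite[OF G(1)] by blast
  have "alg_eval scale (char_poly M) a = (\<Sum>g\<in>G. scale (u g) (alg_eval scale (char_poly M) a * g))"
    using arg_cong[OF u, of "\<lambda>z. alg_eval scale (char_poly M) a * z"]
    by (simp add: sum_distrib_left scale_mult_right)
  also have "\<dots> = 0" using zero by simp
  finally show ?thesis using degree_monic_char_poly[OF M] by (intro that[of "char_poly M"]) auto
qed

end

text \<open>
  The relation \<open>f(s) = a\<close> between \<open>f \<in> K[X]\<close> and elements of the algebra, with a denominator
  of \<open>f\<close> multiplied out. It stands in for evaluation in \<open>A \<otimes>\<^sub>D K\<close>.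
\<close>

definition fract_eval :: "('d::idom \<Rightarrow> 'a::ring_1 \<Rightarrow> 'a) \<Rightarrow> 'd fract poly \<Rightarrow> 'a \<Rightarrow> 'a \<Rightarrow> bool" where
  "fract_eval scale f s a \<longleftrightarrow>
     (\<exists>d g. d \<noteq> 0 \<and> smult (to_fract d) f = fract_poly g \<and> alg_eval scale g s = scale d a)"

lemma fract_poly_pCons: "fract_poly (pCons c p) = pCons (to_fract c) (fract_poly p)"
  by (rule poly_eqI) (simp add: coeff_map_poly coeff_pCons split: nat.splits)

lemma fract_poly_hom:
  "fract_poly (p + q) = fract_poly p + fract_poly q" "fract_poly (p * q) = fract_poly p * fract_poly q"
  by (rule fract_poly_add fract_poly_mult)+

lemma poly_denominator:
  fixes f :: "'d::idom fract poly"
  obtains d g where "d \<noteq> 0" "smult (to_fract d) f = fract_poly g"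
proof -
  obtain d :: 'd where d: "d \<noteq> 0" "\<forall>x\<in>coeff f ` {..degree f}. to_fract d * x \<in> range to_fract"
    using common_denominator[OF finite_imageI[OF finite_atMost, of "coeff f" "degree f"]]
    by (elim exE conjE)
  have "\<forall>i. \<exists>r. to_fract d * coeff f i = to_fract r"
  proof
    fix i
    show "\<exists>r. to_fract d * coeff f i = to_fract r"
    proof (cases "i \<le> degree f")
      case True
      then have "to_fract d * coeff f i \<in> range to_fract" using d(2) by blast
      then show ?thesis by (elim rangeE) (rule exI)
    next
      case False
      then show ?thesis by (intro exI[of _ 0]) (simp add: coeff_eq_0)
    qed
  qed
  then obtain r where r: "\<And>i. to_fract d * coeff f i = to_fract (r i)" by metis
  define g where "g = (\<Sum>i\<le>degree f. monom (r i) i)"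
  have "smult (to_fract d) f = fract_poly g"
  proof (rule poly_eqI)
    fix i
    have "r i = 0" if "degree f < i" using r[of i] that by (simp add: coeff_eq_0)
    then have "coeff g i = r i" by (auto simp: g_def coeff_sum)
    then show "coeff (smult (to_fract d) f) i = coeff (fract_poly g) i"
      by (simp add: coeff_map_poly r)
  qed
  then show ?thesis using d(1) that by blast
qed

context
  fixes scale :: "'d::idom \<Rightarrow> 'a::ring_1 \<Rightarrow> 'a"
  assumes alg: "unital_algebra scale"
begin

interpretation unital_algebra scale by (fact alg)

lemma fract_eval_add:
  assumes "fract_eval scale f s a" "fract_eval scale g s b"
  shows "fract_eval scale (f + g) s (a + b)"
proof -
  obtain d p e q where "d \<noteq> 0" "smult (to_fract d) f = fract_poly p" "alg_eval scale p s = scale d a"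
    "e \<noteq> 0" "smult (to_fract e) g = fract_poly q" "alg_eval scale q s = scale e b"
    using assms unfolding fract_eval_def by blast
  moreover have "smult (to_fract (d * e)) (f + g) =
      smult (to_fract e) (smult (to_fract d) f) + smult (to_fract d) (smult (to_fract e) g)"
    by (simp add: smult_add_right mult.commute)
  ultimately have "d * e \<noteq> 0" "smult (to_fract (d * e)) (f + g) = fract_poly (smult e p + smult d q)"
    "alg_eval scale (smult e p + smult d q) s = scale (d * e) (a + b)"
    by (simp_all add: fract_poly_hom scale_right_distrib mult.commute)
  then show ?thesis unfolding fract_eval_def by blast
qed

lemma fract_eval_mult:
  assumes "fract_eval scale f s a" "fract_eval scale g s b"
  shows "fract_eval scale (f * g) s (a * b)"
proof -
  obtain d p e q where "d \<noteq> 0" "smult (to_fract d) f = fract_poly p" "alg_eval scale p s = scale d a"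
    "e \<noteq> 0" "smult (to_fract e) g = fract_poly q" "alg_eval scale q s = scale e b"
    using assms unfolding fract_eval_def by blast
  moreover have "smult (to_fract (d * e)) (f * g) = smult (to_fract d) f * smult (to_fract e) g"
    by (simp add: mult.commute)
  ultimately have "d * e \<noteq> 0" "smult (to_fract (d * e)) (f * g) = fract_poly (p * q)"
    "alg_eval scale (p * q) s = scale (d * e) (a * b)"
    by (simp_all add: fract_poly_hom mult.commute flip: scale_mult_left scale_mult_right)
  then show ?thesis unfolding fract_eval_def by blast
qed

lemma fract_eval_fract_poly: "fract_eval scale (fract_poly p) s (alg_eval scale p s)"
  unfolding fract_eval_def by (intro exI[of _ 1] exI[of _ p]) simp

lemma fract_eval_const: "fract_eval scale [:to_fract d:] s (scale d 1)"
  using fract_eval_fract_poly[of "[:d:]" s] by (simp add: fract_poly_pCons)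

lemma fract_eval_pcompose:
  assumes "fract_eval scale f s a"
  shows "fract_eval scale (pcompose (fract_poly p) f) s (alg_eval scale p a)"
proof (induction p)
  case 0
  then show ?case using fract_eval_const[of 0 s] by simp
next
  case (pCons c p)
  then show ?case
    using fract_eval_add[OF fract_eval_const fract_eval_mult[OF assms pCons.IH]]
    by (simp add: fract_poly_pCons pcompose_pCons)
qed

lemma fract_eval_mult_zero:
  assumes "fract_eval scale f s 0"
  shows "fract_eval scale (g * f) s 0"
proof -
  obtain d p where f: "d \<noteq> 0" "smult (to_fract d) f = fract_poly p" "alg_eval scale p s = scale d 0"
    using assms unfolding fract_eval_def by blast
  obtain e q where g: "e \<noteq> (0 :: 'd)" "smult (to_fract e) g = fract_poly q" by (rule poly_denominator)
  have "smult (to_fract (d * e)) (g * f) = smult (to_fract e) g * smult (to_fract d) f" by simp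
  with f g have "d * e \<noteq> 0" "smult (to_fract (d * e)) (g * f) = fract_poly (q * p)"
    "alg_eval scale (q * p) s = scale (d * e) 0"
    by (simp_all add: fract_poly_hom)
  then show ?thesis unfolding fract_eval_def by blast
qed

lemma fract_eval_one_zero:
  assumes "torsion_free_module scale"
  shows "\<not> fract_eval scale 1 s 0"
proof
  assume "fract_eval scale 1 s 0"
  then obtain d g where g: "d \<noteq> 0" "smult (to_fract d) 1 = fract_poly g" "alg_eval scale g s = 0"
    unfolding fract_eval_def by auto
  have "fract_poly g = fract_poly [:d:]" using g(2) by (simp add: fract_poly_pCons)
  then have "g = [:d:]" by (simp only: fract_poly_eq_iff)
  then have "scale d 1 = 0" using g(3) by simp
  then show False using assms g(1) unfolding torsion_free_module_def by (metis one_neq_zero)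
qed

text \<open>
  The generator is non-zero because the elements of \<open>S\<close> are integral, and not a unit because \<open>1\<close> does
  not vanish in a torsion-free algebra with \<open>0 \<noteq> 1\<close>.
\<close>

lemma vanishing_polynomial:
  assumes "torsion_free_module scale" "finitely_generated_module scale" "finite S" "S \<noteq> {}"
  obtains \<mu> where "\<mu> \<noteq> 0" "\<not> \<mu> dvd 1" "\<And>f. (\<forall>s\<in>S. fract_eval scale f s 0) \<longleftrightarrow> \<mu> dvd f"
proof -
  define V where "V = {f. \<forall>s\<in>S. fract_eval scale f s 0}"
  have "\<exists>\<mu>\<in>V. \<forall>f\<in>V. \<mu> dvd f"
  proof (rule poly_ideal_principal)
    show "0 \<in> V" using fract_eval_const[of 0] by (simp add: V_def)
    show "f + g \<in> V" if "f \<in> V" "g \<in> V" for f g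
      using that fract_eval_add[of f _ 0 g 0] by (simp add: V_def)
    show "f * g \<in> V" if "g \<in> V" for f g
      using that fract_eval_mult_zero by (simp add: V_def)
  qed
  then obtain \<mu> where \<mu>: "\<mu> \<in> V" "\<And>f. f \<in> V \<Longrightarrow> \<mu> dvd f" by blast
  have V: "f \<in> V \<longleftrightarrow> \<mu> dvd f" for f
  proof
    assume "\<mu> dvd f"
    then obtain h where "f = h * \<mu>" by (metis dvdE mult.commute)
    then show "f \<in> V" using \<mu>(1) fract_eval_mult_zero by (simp add: V_def)
  qed (rule \<mu>(2))
  have "\<forall>s. \<exists>p. lead_coeff p = 1 \<and> alg_eval scale p s = 0"
    using finitely_generated_integral[OF assms(2)] by blast
  then obtain p where p: "\<And>s. lead_coeff (p s) = 1" "\<And>s. alg_eval scale (p s) s = 0" by metis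
  have "fract_eval scale (fract_poly (prod p S)) s 0" if "s \<in> S" for s
  proof -
    have "alg_eval scale (prod p S) s = 0"
      by (rule alg_eval_prod_eq_0[OF assms(3) that p(2)])
    then show ?thesis using fract_eval_fract_poly[of "prod p S" s] by (simp only:)
  qed
  then have "fract_poly (prod p S) \<in> V" by (simp only: V_def mem_Collect_eq) blast
  moreover have "prod p S \<noteq> 0" using p(1) assms(3) by (metis leading_coeff_0_iff prod_zero_iff zero_neq_one)
  ultimately have "\<mu> \<noteq> 0" using V by (metis dvd_0_left_iff fract_poly_eq_0_iff)
  moreover have "\<not> \<mu> dvd 1"
    using assms(4) fract_eval_one_zero[OF assms(1)] unfolding V[symmetric] by (auto simp: V_def)
  ultimately show ?thesis using that[of \<mu>] V unfolding V_def by blast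
qed

text \<open>
  Multiply monic annihilators of the values \<open>f(s) \<in> A\<close> to one \<open>P\<close>. Then \<open>P(f)\<close> vanishes on \<open>S\<close>, so
  \<open>\<mu>\<close> divides it and \<open>P(f(\<alpha>)) = 0\<close>.
\<close>

lemma int_valued_roots_integral:
  assumes "finitely_generated_module scale" "finite S"
    and \<mu>: "\<And>f. (\<forall>s\<in>S. fract_eval scale f s 0) \<longleftrightarrow> \<mu> dvd f"
    and f: "\<And>s. s \<in> S \<Longrightarrow> \<exists>a. fract_eval scale f s a"
    and \<alpha>: "ac_eval \<mu> \<alpha> = 0"
  shows "ac_eval f \<alpha> \<in> alg_ints"
proof -
  have "\<forall>s\<in>S. \<exists>a. fract_eval scale f s a" using f by blast
  from bchoice[OF this] obtain a where a: "\<And>s. s \<in> S \<Longrightarrow> fract_eval scale f s (a s)" by blast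
  have "\<forall>s. \<exists>p. lead_coeff p = 1 \<and> alg_eval scale p (a s) = 0"
    using finitely_generated_integral[OF assms(1)] by blast
  from choice[OF this] obtain p
    where p: "\<And>s. lead_coeff (p s) = 1" "\<And>s. alg_eval scale (p s) (a s) = 0" by blast
  define P where "P = prod p S"
  have "lead_coeff P = 1" unfolding P_def using p(1) by (simp add: lead_coeff_prod)
  have "fract_eval scale (pcompose (fract_poly P) f) s 0" if "s \<in> S" for s
  proof -
    have "alg_eval scale P (a s) = 0"
      unfolding P_def by (rule alg_eval_prod_eq_0[OF assms(2) that p(2)])
    then show ?thesis using fract_eval_pcompose[OF a[OF that], of P] by simp
  qed
  then have "\<mu> dvd pcompose (fract_poly P) f" using \<mu> by blast
  then obtain h where "pcompose (fract_poly P) f = \<mu> * h" by (rule dvdE)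
  then have "ac_eval (pcompose (fract_poly P) f) \<alpha> = 0" using \<alpha> by simp
  then have root: "ac_eval (fract_poly P) (ac_eval f \<alpha>) = 0" by (simp add: ac_eval_pcompose)
  define p' where "p' = map_poly to_ac (fract_poly P)"
  have "integral_over (range (\<lambda>d::'d. to_ac (to_fract d))) (ac_eval f \<alpha>)"
    unfolding integral_over_def
  proof (intro exI[of _ p'] conjI allI)
    have "degree (fract_poly P) = degree P"
      using \<open>lead_coeff P = 1\<close> by (intro map_poly_degree_eq) simp
    moreover have "degree p' = degree (fract_poly P)"
      unfolding p'_def using \<open>lead_coeff P = 1\<close> calculation by (intro map_poly_degree_eq) (simp add: coeff_map_poly)
    ultimately show "lead_coeff p' = 1"
      using \<open>lead_coeff P = 1\<close> by (simp add: p'_def coeff_map_poly)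
    show "coeff p' i \<in> range (\<lambda>d::'d. to_ac (to_fract d))" for i
      by (simp add: p'_def coeff_map_poly)
    show "poly p' (ac_eval f \<alpha>) = 0" using root by (simp add: p'_def ac_eval_def)
  qed
  then show ?thesis by (simp add: alg_ints_def integral_closure_def)
qed

end

section \<open>The tensor product as a quotient of a free ring\<close>

lemma frag_extend_fun_diff:
  fixes f g :: "'k \<Rightarrow> 'l \<Rightarrow>\<^sub>0 int"
  shows "frag_extend (\<lambda>x. f x - g x) u = frag_extend f u - frag_extend g u"
proof -
  have "frag_cmul c (v - w) = frag_cmul c v - frag_cmul c w" for c and v w :: "'l \<Rightarrow>\<^sub>0 int"
    by (rule poly_mapping_eqI) (simp add: lookup_minus right_diff_distrib)
  then show ?thesis by (simp add: frag_extend_def sum_subtractf)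
qed

definition free_pair_mult :: "('a::ring_1 \<times> 'b::ring_1 \<Rightarrow>\<^sub>0 int) \<Rightarrow> ('a \<times> 'b \<Rightarrow>\<^sub>0 int) \<Rightarrow> ('a \<times> 'b \<Rightarrow>\<^sub>0 int)" where
  "free_pair_mult u v = frag_extend (\<lambda>(a, b). frag_extend (\<lambda>(a', b'). frag_of (a * a', b * b')) v) u"

lemma free_pair_mult_of [simp]: "free_pair_mult (frag_of (a, b)) (frag_of (a', b')) = frag_of (a * a', b * b')"
  by (simp add: free_pair_mult_def)

lemma free_pair_mult_diff_left: "free_pair_mult (u - v) w = free_pair_mult u w - free_pair_mult v w"
  by (simp add: free_pair_mult_def frag_extend_diff)

lemma free_pair_mult_diff_right: "free_pair_mult w (u - v) = free_pair_mult w u - free_pair_mult w v"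
proof -
  have "(\<lambda>(a, b). frag_extend (\<lambda>(a', b'). frag_of (a * a', b * b')) (u - v)) =
    (\<lambda>x. (\<lambda>(a, b). frag_extend (\<lambda>(a', b'). frag_of (a * a', b * b')) u) x -
         (\<lambda>(a, b). frag_extend (\<lambda>(a', b'). frag_of (a * a', b * b')) v) x)"
    by (auto simp: frag_extend_diff)
  then show ?thesis unfolding free_pair_mult_def by (simp only: frag_extend_fun_diff)
qed

lemma free_pair_mult_0 [simp]: "free_pair_mult 0 u = 0" "free_pair_mult u 0 = 0"
  using free_pair_mult_diff_left[of 0 0 u] free_pair_mult_diff_right[of u 0 0] by simp_all

lemma free_pair_mult_add_left: "free_pair_mult (u + v) w = free_pair_mult u w + free_pair_mult v w"
  using free_pair_mult_diff_left[of u "0 - v" w] free_pair_mult_diff_left[of 0 v w] by simp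

lemma free_pair_mult_add_right: "free_pair_mult w (u + v) = free_pair_mult w u + free_pair_mult w v"
  using free_pair_mult_diff_right[of w u "0 - v"] free_pair_mult_diff_right[of w 0 v] by simp

lemma frag_induct_diff [case_names zero one diff]:
  assumes "P 0" "\<And>a b. P (frag_of (a, b))" "\<And>u v. P u \<Longrightarrow> P v \<Longrightarrow> P (u - v)"
  shows "P (c :: 'a \<times> 'b \<Rightarrow>\<^sub>0 int)"
  using subset_UNIV[of "Poly_Mapping.keys c"]
proof (induction c rule: frag_induction)
  case (one x)
  then show ?case using assms(2)[of "fst x" "snd x"] by simp
qed (use assms in auto)

lemma free_pair_mult_assoc: "free_pair_mult (free_pair_mult u v) w = free_pair_mult u (free_pair_mult v w)"
proof (induction u rule: frag_induct_diff)
  case (one a b)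
  show ?case
  proof (induction v rule: frag_induct_diff)
    case (one a' b')
    show ?case
      by (induction w rule: frag_induct_diff) (simp_all add: free_pair_mult_diff_right mult.assoc)
  qed (simp_all add: free_pair_mult_diff_left free_pair_mult_diff_right)
qed (simp_all add: free_pair_mult_diff_left)

lemma free_pair_mult_one: "free_pair_mult (frag_of (1, 1)) u = u" "free_pair_mult u (frag_of (1, 1)) = u"
  by (induction u rule: frag_induct_diff) (simp_all add: free_pair_mult_diff_left free_pair_mult_diff_right)

lemma free_pair_ring_simps [simp]:
  "carrier free_pair_ring = UNIV" "u \<otimes>\<^bsub>free_pair_ring\<^esub> v = free_pair_mult u v"
  "\<one>\<^bsub>free_pair_ring\<^esub> = frag_of (1, 1)" "\<zero>\<^bsub>free_pair_ring\<^esub> = 0"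
  "u \<oplus>\<^bsub>free_pair_ring\<^esub> v = u + v"
  by (simp_all add: free_pair_ring_def free_pair_mult_def)

lemma ring_free_pair_ring: "ring free_pair_ring"
proof (rule ringI)
  show "abelian_group free_pair_ring"
    by (rule abelian_groupI) (auto simp: add.assoc add.commute intro: exI[of _ "- _"])
  show "monoid free_pair_ring"
    by unfold_locales (auto simp: free_pair_mult_assoc free_pair_mult_one)
qed (auto simp: free_pair_mult_add_left free_pair_mult_add_right)

lemma a_inv_free_pair_ring: "\<ominus>\<^bsub>free_pair_ring\<^esub> u = - u"
proof -
  interpret F: ring free_pair_ring by (rule ring_free_pair_ring)
  show ?thesis by (rule F.minus_equality) simp_all
qed

lemma unital_algebra_fract_scale: "unital_algebra (fract_scale :: 'd::idom \<Rightarrow> _)"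
  by unfold_locales (simp_all add: fract_scale_def algebra_simps)

context
  fixes sA :: "'d::comm_ring_1 \<Rightarrow> 'a::ring_1 \<Rightarrow> 'a" and sB :: "'d \<Rightarrow> 'b::ring_1 \<Rightarrow> 'b"
  assumes A: "unital_algebra sA" and B: "unital_algebra sB"
begin

lemma tensor_kernel_subgroup: "subgroup (tensor_kernel sA sB) (add_monoid free_pair_ring)"
proof -
  interpret F: ring free_pair_ring by (rule ring_free_pair_ring)
  show ?thesis unfolding tensor_kernel_def
    by (rule F.add.generate_is_subgroup) simp
qed

lemma tensor_kernel_0: "0 \<in> tensor_kernel sA sB"
  and tensor_kernel_add: "u \<in> tensor_kernel sA sB \<Longrightarrow> v \<in> tensor_kernel sA sB \<Longrightarrow> u + v \<in> tensor_kernel sA sB"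
  and tensor_kernel_minus: "u \<in> tensor_kernel sA sB \<Longrightarrow> - u \<in> tensor_kernel sA sB"
  using subgroup.one_closed[OF tensor_kernel_subgroup] subgroup.m_closed[OF tensor_kernel_subgroup, of u v]
    subgroup.m_inv_closed[OF tensor_kernel_subgroup, of u] a_inv_free_pair_ring[of u]
  by (simp_all add: a_inv_def)

lemma tensor_kernel_diff:
  "u \<in> tensor_kernel sA sB \<Longrightarrow> v \<in> tensor_kernel sA sB \<Longrightarrow> u - v \<in> tensor_kernel sA sB"
  using tensor_kernel_add[OF _ tensor_kernel_minus, of u v] by simp

lemma tensor_kernel_relator: "r \<in> tensor_relators sA sB \<Longrightarrow> r \<in> tensor_kernel sA sB"
  unfolding tensor_kernel_def by (rule generate.incl)

lemma tensor_kernel_induct [consumes 1, case_names zero relator minus add]: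
  assumes "u \<in> tensor_kernel sA sB" and "P 0" and "\<And>r. r \<in> tensor_relators sA sB \<Longrightarrow> P r"
    and "\<And>r. P r \<Longrightarrow> P (- r)" and "\<And>u v. P u \<Longrightarrow> P v \<Longrightarrow> P (u + v)"
  shows "P u"
  using assms(1) unfolding tensor_kernel_def
proof (induction u rule: generate.induct)
  case one
  then show ?case using assms(2) by simp
next
  case (incl h)
  then show ?case by (rule assms(3))
next
  case (inv h)
  then show ?case using assms(3,4)[of h] a_inv_free_pair_ring[of h] by (simp add: a_inv_def)
next
  case (eng h1 h2)
  then show ?case using assms(5) by simp
qed

text \<open>
  What makes the kernel a two-sided ideal: scalars pass through a product on either side.
\<close>

lemma relator_mult:
  assumes "r \<in> tensor_relators sA sB"
  shows "free_pair_mult (frag_of (c, e)) r \<in> tensor_relators sA sB"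
    "free_pair_mult r (frag_of (c, e)) \<in> tensor_relators sA sB"
proof -
  interpret A: unital_algebra sA by (rule A)
  interpret B: unital_algebra sB by (rule B)
  consider (1) a a' b where "r = frag_of (a + a', b) - frag_of (a, b) - frag_of (a', b)"
    | (2) a b b' where "r = frag_of (a, b + b') - frag_of (a, b) - frag_of (a, b')"
    | (3) d a b where "r = frag_of (sA d a, b) - frag_of (a, sB d b)"
    using assms unfolding tensor_relators_def by blast
  then have "free_pair_mult (frag_of (c, e)) r \<in> tensor_relators sA sB \<and>
    free_pair_mult r (frag_of (c, e)) \<in> tensor_relators sA sB"
  proof cases
    case 1
    have "free_pair_mult (frag_of (c, e)) r = frag_of (c * a + c * a', e * b) - frag_of (c * a, e * b) - frag_of (c * a', e * b)"
      "free_pair_mult r (frag_of (c, e)) = frag_of (a * c + a' * c, b * e) - frag_of (a * c, b * e) - frag_of (a' * c, b * e)"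
      unfolding 1 by (simp_all add: free_pair_mult_diff_left free_pair_mult_diff_right distrib_left distrib_right)
    then show ?thesis unfolding tensor_relators_def by blast
  next
    case 2
    have "free_pair_mult (frag_of (c, e)) r = frag_of (c * a, e * b + e * b') - frag_of (c * a, e * b) - frag_of (c * a, e * b')"
      "free_pair_mult r (frag_of (c, e)) = frag_of (a * c, b * e + b' * e) - frag_of (a * c, b * e) - frag_of (a * c, b' * e)"
      unfolding 2 by (simp_all add: free_pair_mult_diff_left free_pair_mult_diff_right distrib_left distrib_right)
    then show ?thesis unfolding tensor_relators_def by blast
  next
    case 3
    have "free_pair_mult (frag_of (c, e)) r = frag_of (sA d (c * a), e * b) - frag_of (c * a, sB d (e * b))"
      unfolding 3 by (simp add: free_pair_mult_diff_right A.scale_mult_right B.scale_mult_right)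
    moreover have "free_pair_mult r (frag_of (c, e)) = frag_of (sA d (a * c), b * e) - frag_of (a * c, sB d (b * e))"
      unfolding 3 by (simp add: free_pair_mult_diff_left A.scale_mult_left B.scale_mult_left)
    ultimately show ?thesis unfolding tensor_relators_def by blast
  qed
  then show "free_pair_mult (frag_of (c, e)) r \<in> tensor_relators sA sB"
    "free_pair_mult r (frag_of (c, e)) \<in> tensor_relators sA sB" by blast+
qed

lemma tensor_kernel_mult:
  assumes "u \<in> tensor_kernel sA sB"
  shows "free_pair_mult w u \<in> tensor_kernel sA sB" "free_pair_mult u w \<in> tensor_kernel sA sB"
proof -
  note neg = free_pair_mult_diff_left[of 0, simplified] free_pair_mult_diff_right[of _ 0, simplified]
  have "free_pair_mult (frag_of (c, e)) u \<in> tensor_kernel sA sB \<and> free_pair_mult u (frag_of (c, e)) \<in> tensor_kernel sA sB" for c e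
    using assms
    by (induction u rule: tensor_kernel_induct)
      (simp_all add: tensor_kernel_0 tensor_kernel_relator relator_mult neg tensor_kernel_minus
        free_pair_mult_add_left free_pair_mult_add_right tensor_kernel_add)
  then have "free_pair_mult w u \<in> tensor_kernel sA sB \<and> free_pair_mult u w \<in> tensor_kernel sA sB"
    by (induction w rule: frag_induct_diff)
      (simp_all add: tensor_kernel_0 free_pair_mult_diff_left free_pair_mult_diff_right tensor_kernel_diff)
  then show "free_pair_mult w u \<in> tensor_kernel sA sB" "free_pair_mult u w \<in> tensor_kernel sA sB" by blast+
qed

lemma ideal_tensor_kernel: "ideal (tensor_kernel sA sB) free_pair_ring"
  by (rule idealI[OF ring_free_pair_ring tensor_kernel_subgroup]) (simp_all add: tensor_kernel_mult)

lemma coset_eq_iff: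
  "tensor_kernel sA sB +>\<^bsub>free_pair_ring\<^esub> u = tensor_kernel sA sB +>\<^bsub>free_pair_ring\<^esub> v \<longleftrightarrow>
    u - v \<in> tensor_kernel sA sB"
proof -
  interpret F: ring free_pair_ring by (rule ring_free_pair_ring)
  show ?thesis
    using F.quotient_eq_iff_same_a_r_cos[OF ideal_tensor_kernel, of u v]
    by (simp add: a_minus_def a_inv_free_pair_ring)
qed

text \<open>
  Pull the sum back along the quotient map: in the free ring \<open>(1, c) (s, 1)^i = (s^i, c)\<close>.
\<close>

lemma tensor_ring_eval:
  assumes "finite I"
  shows "(\<Oplus>\<^bsub>tensor_ring sA sB\<^esub> i \<in> I. pure_tensor sA sB 1 (c i) \<otimes>\<^bsub>tensor_ring sA sB\<^esub>
      (pure_tensor sA sB s 1 [^]\<^bsub>tensor_ring sA sB\<^esub> (i :: nat))) =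
    tensor_kernel sA sB +>\<^bsub>free_pair_ring\<^esub> (\<Sum>i\<in>I. frag_of (s ^ i, c i))"
proof -
  let ?h = "\<lambda>u. tensor_kernel sA sB +>\<^bsub>free_pair_ring\<^esub> u"
  interpret h: ring_hom_ring free_pair_ring "tensor_ring sA sB" ?h
    unfolding tensor_ring_def by (rule ideal.rcos_ring_hom_ring[OF ideal_tensor_kernel])
  have pow: "frag_of (s, 1) [^]\<^bsub>free_pair_ring\<^esub> i = frag_of (s ^ i, 1 :: 'b)" for i :: nat
    by (induction i) (simp_all add: power_commutes)
  have "pure_tensor sA sB 1 (c i) \<otimes>\<^bsub>tensor_ring sA sB\<^esub>
      (pure_tensor sA sB s 1 [^]\<^bsub>tensor_ring sA sB\<^esub> i) = ?h (frag_of (s ^ i, c i))" for i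
  proof -
    have "pure_tensor sA sB s 1 [^]\<^bsub>tensor_ring sA sB\<^esub> i = ?h (frag_of (s ^ i, 1))"
      unfolding pure_tensor_def by (subst h.hom_nat_pow[symmetric]) (simp_all add: pow)
    then have "pure_tensor sA sB 1 (c i) \<otimes>\<^bsub>tensor_ring sA sB\<^esub>
        (pure_tensor sA sB s 1 [^]\<^bsub>tensor_ring sA sB\<^esub> i) =
      ?h (frag_of (1, c i) \<otimes>\<^bsub>free_pair_ring\<^esub> frag_of (s ^ i, 1))"
      unfolding pure_tensor_def by (subst h.hom_mult) simp_all
    then show ?thesis by simp
  qed
  moreover have "(\<Oplus>\<^bsub>tensor_ring sA sB\<^esub> i \<in> I. ?h (w i)) = ?h (\<Sum>i\<in>I. w i)" for w
    using assms
  proof (induction I rule: finite_induct)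
    case empty
    then show ?case using h.hom_zero by simp
  next
    case (insert i I)
    have "?h u \<in> carrier (tensor_ring sA sB)" for u using h.hom_closed by simp
    then show ?case using insert h.hom_add[of "w i" "\<Sum>i\<in>I. w i"] by (simp add: h.S.finsum_insert)
  qed
  ultimately show ?thesis by simp
qed

end

section \<open>Evaluation in the extended algebra\<close>

definition frag_lift :: "('k \<Rightarrow> 'a::ring_1) \<Rightarrow> ('k \<Rightarrow>\<^sub>0 int) \<Rightarrow> 'a" where
  "frag_lift \<phi> u = (\<Sum>k\<in>Poly_Mapping.keys u. of_int (Poly_Mapping.lookup u k) * \<phi> k)"

lemma frag_lift_superset:
  assumes "finite T" "Poly_Mapping.keys u \<subseteq> T"
  shows "frag_lift \<phi> u = (\<Sum>k\<in>T. of_int (Poly_Mapping.lookup u k) * \<phi> k)"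
  unfolding frag_lift_def using assms
  by (intro sum.mono_neutral_left) (auto simp: in_keys_iff)

lemma frag_lift_diff: "frag_lift \<phi> (u - v) = frag_lift \<phi> u - frag_lift \<phi> v"
proof -
  define T where "T = Poly_Mapping.keys u \<union> Poly_Mapping.keys v"
  have "finite T" "Poly_Mapping.keys u \<subseteq> T" "Poly_Mapping.keys v \<subseteq> T" "Poly_Mapping.keys (u - v) \<subseteq> T"
    using keys_diff[of u v] by (auto simp: T_def)
  then show ?thesis
    by (simp add: frag_lift_superset[of T] lookup_minus sum_subtractf left_diff_distrib)
qed

lemma frag_lift_of [simp]: "frag_lift \<phi> (frag_of k) = \<phi> k"
  by (simp add: frag_lift_def)

lemma frag_lift_0 [simp]: "frag_lift \<phi> 0 = 0"
  by (simp add: frag_lift_def)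

lemma frag_lift_minus: "frag_lift \<phi> (- u) = - frag_lift \<phi> u"
  using frag_lift_diff[of \<phi> 0 u] by simp

lemma frag_lift_add: "frag_lift \<phi> (u + v) = frag_lift \<phi> u + frag_lift \<phi> v"
  using frag_lift_diff[of \<phi> u "- v"] by (simp add: frag_lift_minus)

lemma frag_lift_sum: "frag_lift \<phi> (sum w I) = (\<Sum>i\<in>I. frag_lift \<phi> (w i))"
  by (induction I rule: infinite_finite_induct) (simp_all add: frag_lift_add)

text \<open>
  Meaningful only if \<open>e\<close> is a denominator of \<open>x\<close>.
\<close>

definition numerator :: "'d::idom \<Rightarrow> 'd fract \<Rightarrow> 'd" where
  "numerator e x = (THE r. to_fract r = to_fract e * x)"

lemma two_denominators:
  fixes x y :: "'d::idom fract"
  obtains d r s where "d \<noteq> 0" "to_fract d * x = to_fract r" "to_fract d * y = to_fract s"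
proof -
  have "\<exists>d::'d. d \<noteq> 0 \<and> (\<forall>z\<in>{x, y}. to_fract d * z \<in> range to_fract)"
    by (rule common_denominator) simp
  then obtain d :: 'd where "d \<noteq> 0" "to_fract d * x \<in> range to_fract" "to_fract d * y \<in> range to_fract"
    by blast
  then show ?thesis by (elim rangeE) (rule that)
qed

lemma numerator_eq:
  assumes "to_fract e * x = to_fract r"
  shows "numerator e x = r"
  unfolding numerator_def assms by (rule the_equality) simp_all

text \<open>
  The map \<open>a \<otimes> x \<mapsto> (e x) a\<close>, additive on formal sums of pairs. It is compatible with the relators only if
  \<open>e\<close> is a denominator of the field elements that occur, which is why the two lemmas on the kernel
  below speak of all multiples of a suitable \<open>d\<close>.
\<close>

definition clear :: "('d::idom \<Rightarrow> 'a::ring_1 \<Rightarrow> 'a) \<Rightarrow> 'd \<Rightarrow> ('a \<times> 'd fract \<Rightarrow>\<^sub>0 int) \<Rightarrow> 'a" where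
  "clear scale e = frag_lift (\<lambda>(a, x). scale (numerator e x) a)"

lemmas frag_lift_simps = frag_lift_diff frag_lift_minus frag_lift_add frag_lift_sum

context
  fixes scale :: "'d::idom \<Rightarrow> 'a::ring_1 \<Rightarrow> 'a"
  assumes alg: "unital_algebra scale"
begin

interpretation unital_algebra scale by (fact alg)

text \<open>
  For a sum of relators take the product of denominators for the summands; quantifying over all
  multiples \<open>d * k\<close> is what lets the induction pass through sums.
\<close>

lemma tensor_kernel_clear_eq_0:
  assumes "u \<in> tensor_kernel scale fract_scale"
  shows "\<exists>d. d \<noteq> 0 \<and> (\<forall>k. clear scale (d * k) u = 0)"
  using assms
proof (induction u rule: tensor_kernel_induct[OF alg unital_algebra_fract_scale,
      consumes 1, case_names zero relator minus add])
  case zero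
  show ?case by (intro exI[of _ 1]) (simp add: clear_def)
next
  case (relator r)
  consider (1) a a' b where "r = frag_of (a + a', b) - frag_of (a, b) - frag_of (a', b)"
    | (2) a b b' where "r = frag_of (a, b + b') - frag_of (a, b) - frag_of (a, b')"
    | (3) c a b where "r = frag_of (scale c a, b) - frag_of (a, fract_scale c b)"
    using relator unfolding tensor_relators_def by blast
  then show ?case
  proof cases
    case 1
    then show ?thesis
      by (intro exI[of _ 1]) (simp add: clear_def frag_lift_simps scale_right_distrib)
  next
    case 2
    obtain d r1 r2 where d: "d \<noteq> 0"
      and r: "to_fract d * b = to_fract r1" "to_fract d * b' = to_fract r2" by (rule two_denominators)
    have "clear scale (d * k) r = 0" for k
    proof -
      have "to_fract (d * k) * b = to_fract (k * r1)" "to_fract (d * k) * b' = to_fract (k * r2)"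
        by (simp_all only: to_fract_mult r[symmetric] mult_ac)
      moreover from this have "to_fract (d * k) * (b + b') = to_fract (k * r1 + k * r2)"
        by (simp only: distrib_left to_fract_add)
      ultimately have "numerator (d * k) b = k * r1" "numerator (d * k) b' = k * r2"
        "numerator (d * k) (b + b') = k * r1 + k * r2"
        by (auto intro: numerator_eq)
      then show ?thesis unfolding 2 by (simp add: clear_def frag_lift_simps scale_left_distrib)
    qed
    then show ?thesis using d by blast
  next
    case 3
    obtain d r1 where d: "d \<noteq> 0" and r: "to_fract d * b = to_fract r1"
      by (rule two_denominators[of b b])
    have "clear scale (d * k) r = 0" for k
    proof -
      have 1: "to_fract (d * k) * b = to_fract (k * r1)"
        by (simp only: to_fract_mult r[symmetric] mult_ac)
      have "to_fract (d * k) * fract_scale c b = to_fract c * (to_fract (d * k) * b)"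
        by (simp only: fract_scale_def mult_ac)
      also have "\<dots> = to_fract (c * (k * r1))" unfolding 1 by simp
      finally have "numerator (d * k) (fract_scale c b) = c * (k * r1)" by (rule numerator_eq)
      moreover have "numerator (d * k) b = k * r1" using 1 by (rule numerator_eq)
      ultimately show ?thesis unfolding 3 by (simp add: clear_def frag_lift_simps mult_ac)
    qed
    then show ?thesis using d by blast
  qed
next
  case (minus r)
  then show ?case by (simp add: clear_def frag_lift_simps)
next
  case (add u v)
  then obtain d e where "d \<noteq> 0" "\<forall>k. clear scale (d * k) u = 0" "e \<noteq> 0" "\<forall>k. clear scale (e * k) v = 0"
    by blast
  moreover from this have "clear scale (d * e * k) u = 0" "clear scale (d * e * k) v = 0" for k
    by (metis mult.assoc, metis mult.assoc mult.commute)
  ultimately have "d * e \<noteq> 0" "\<forall>k. clear scale (d * e * k) (u + v) = 0"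
    by (simp_all add: clear_def frag_lift_simps)
  then show ?case by blast
qed

lemma frag_of_0_in_kernel: "frag_of (0, x) \<in> tensor_kernel scale fract_scale"
proof -
  have "frag_of (0 + 0, x) - frag_of (0, x) - frag_of (0, x) \<in> tensor_relators scale fract_scale"
    unfolding tensor_relators_def by blast
  from tensor_kernel_minus[OF alg unital_algebra_fract_scale tensor_kernel_relator[OF alg unital_algebra_fract_scale this]]
  show ?thesis by simp
qed

text \<open>
  Every tensor is a pure tensor \<open>b \<otimes> 1/e\<close> with \<open>e = d * k\<close>. By \<open>tensor_kernel_clear_eq_0\<close> it lies in the kernel
  iff \<open>b = 0\<close> for a suitable \<open>d\<close>.
\<close>

lemma tensor_single_denominator:
  "\<exists>d. d \<noteq> 0 \<and> (\<forall>k. k \<noteq> 0 \<longrightarrow>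
     u - frag_of (clear scale (d * k) u, inverse (to_fract (d * k))) \<in> tensor_kernel scale fract_scale)"
proof (induction u rule: frag_induct_diff)
  note K = tensor_kernel_minus[OF alg unital_algebra_fract_scale]
    tensor_kernel_diff[OF alg unital_algebra_fract_scale] tensor_kernel_add[OF alg unital_algebra_fract_scale]
    tensor_kernel_relator[OF alg unital_algebra_fract_scale]
  {
    case zero
    show ?case using K(1)[OF frag_of_0_in_kernel] by (intro exI[of _ 1]) (simp add: clear_def)
  next
    case (one a x)
    obtain d r where d: "d \<noteq> 0" and r: "to_fract d * x = to_fract r"
      by (rule two_denominators[of x x])
    have "frag_of (a, x) - frag_of (clear scale (d * k) (frag_of (a, x)), inverse (to_fract (d * k)))
      \<in> tensor_kernel scale fract_scale" if "k \<noteq> 0" for k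
    proof -
      have 1: "to_fract (d * k) * x = to_fract (k * r)"
        by (simp only: to_fract_mult r[symmetric] mult_ac)
      then have "numerator (d * k) x = k * r" by (rule numerator_eq)
      then have c: "clear scale (d * k) (frag_of (a, x)) = scale (k * r) a" by (simp add: clear_def)
      have "x = to_fract (k * r) * inverse (to_fract (d * k))"
        using 1[symmetric] d that by (simp del: to_fract_mult)
      then have x: "x = fract_scale (k * r) (inverse (to_fract (d * k)))" by (simp only: fract_scale_def)
      have "frag_of (scale (k * r) a, inverse (to_fract (d * k))) -
        frag_of (a, fract_scale (k * r) (inverse (to_fract (d * k)))) \<in> tensor_relators scale fract_scale"
        unfolding tensor_relators_def by blast
      from K(1)[OF K(4)[OF this]] show ?thesis unfolding c x[symmetric] by simp
    qed
    then show ?case using d by blast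
  next
    case (diff u v)
    obtain d e where de: "d \<noteq> 0" "e \<noteq> 0"
      "\<And>k. k \<noteq> 0 \<Longrightarrow> u - frag_of (clear scale (d * k) u, inverse (to_fract (d * k))) \<in> tensor_kernel scale fract_scale"
      "\<And>k. k \<noteq> 0 \<Longrightarrow> v - frag_of (clear scale (e * k) v, inverse (to_fract (e * k))) \<in> tensor_kernel scale fract_scale"
      using diff.IH by blast
    have "(u - v) - frag_of (clear scale (d * e * k) (u - v), inverse (to_fract (d * e * k)))
      \<in> tensor_kernel scale fract_scale" if k: "k \<noteq> 0" for k
    proof -
      define b where "b = inverse (to_fract (d * e * k))"
      define p q where "p = clear scale (d * e * k) u" and "q = clear scale (d * e * k) v"
      have "u - frag_of (p, b) \<in> tensor_kernel scale fract_scale"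
        using de(3)[of "e * k"] de k by (simp add: p_def b_def mult.assoc del: to_fract_mult)
      moreover have "v - frag_of (q, b) \<in> tensor_kernel scale fract_scale"
        using de(4)[of "d * k"] de k by (simp add: q_def b_def mult.assoc mult.left_commute[of d e] del: to_fract_mult)
      moreover have "frag_of ((p - q) + q, b) - frag_of (p - q, b) - frag_of (q, b) \<in> tensor_relators scale fract_scale"
        unfolding tensor_relators_def by blast
      ultimately have "((u - frag_of (p, b)) - (v - frag_of (q, b))) +
        (frag_of ((p - q) + q, b) - frag_of (p - q, b) - frag_of (q, b)) \<in> tensor_kernel scale fract_scale"
        by (rule K(3)[OF K(2) K(4)])
      moreover have "clear scale (d * e * k) (u - v) = p - q" by (simp add: p_def q_def clear_def frag_lift_simps)
      ultimately show ?thesis by (simp add: b_def)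
    qed
    then show ?case using de(1,2) by (intro exI[of _ "d * e"]) simp
  }
qed

lemma eval_extended_eq_embed_iff:
  assumes tf: "torsion_free_module scale"
  shows "eval_extended scale f (embed_alg scale s) = embed_alg scale a \<longleftrightarrow> fract_eval scale f s a"
proof -
  define w where "w = (\<Sum>i\<le>degree f. frag_of (s ^ i, coeff f i)) - frag_of (a, 1)"
  have "eval_extended scale f (embed_alg scale s) =
    tensor_kernel scale fract_scale +>\<^bsub>free_pair_ring\<^esub> (\<Sum>i\<le>degree f. frag_of (s ^ i, coeff f i))"
    unfolding eval_extended_def extended_algebra_def embed_field_def embed_alg_def
    by (rule tensor_ring_eval[OF alg unital_algebra_fract_scale]) simp
  then have kernel: "eval_extended scale f (embed_alg scale s) = embed_alg scale a \<longleftrightarrow> w \<in> tensor_kernel scale fract_scale"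
    by (simp add: embed_alg_def pure_tensor_def coset_eq_iff[OF alg unital_algebra_fract_scale] w_def)
  \<comment> \<open>Both directions compute the cleared form of \<open>w\<close>: it is \<open>k\<close> times the defect of \<open>(d f)(s) = d a\<close>.\<close>
  have clear_w: "clear scale (d * k) w = scale k (alg_eval scale g s - scale d a)"
    if g: "smult (to_fract d) f = fract_poly g" and "d \<noteq> 0" for d g k
  proof -
    have "numerator (d * k) (coeff f i) = k * coeff g i" for i
    proof (rule numerator_eq)
      have co: "to_fract d * coeff f i = to_fract (coeff g i)"
        using arg_cong[OF g, of "\<lambda>p. coeff p i"] by (simp add: coeff_map_poly)
      have "to_fract (d * k) * coeff f i = to_fract k * (to_fract d * coeff f i)"
        by (simp only: to_fract_mult mult_ac)
      then show "to_fract (d * k) * coeff f i = to_fract (k * coeff g i)"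
        by (simp only: co to_fract_mult)
    qed
    moreover have "numerator (d * k) 1 = k * d" by (rule numerator_eq) (simp add: mult.commute)
    ultimately have "clear scale (d * k) w = (\<Sum>i\<le>degree f. scale (k * coeff g i) (s ^ i)) - scale (k * d) a"
      by (simp add: w_def clear_def frag_lift_simps)
    moreover have "degree g \<le> degree f"
    proof (rule degree_le, intro allI impI)
      fix i assume "degree f < i"
      then have "to_fract (coeff g i) = 0"
        using arg_cong[OF g, of "\<lambda>p. coeff p i"] by (simp add: coeff_map_poly coeff_eq_0)
      then show "coeff g i = 0" by simp
    qed
    ultimately show ?thesis
      by (simp add: alg_eval_bound[of g "degree f"] scale_right_diff_distrib scale_sum_right)
  qed
  show ?thesis unfolding kernel
  proof
    assume "w \<in> tensor_kernel scale fract_scale"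
    then obtain d where d: "d \<noteq> 0" "\<And>k. clear scale (d * k) w = 0" using tensor_kernel_clear_eq_0 by blast
    obtain e g where e: "e \<noteq> 0" "smult (to_fract e) f = fract_poly g" by (rule poly_denominator)
    have "scale d (alg_eval scale g s - scale e a) = 0"
      using clear_w[OF e(2,1), of d] d(2)[of e] by (simp add: mult.commute)
    then have "alg_eval scale g s - scale e a = 0"
      using tf d(1) unfolding torsion_free_module_def by blast
    then have "alg_eval scale g s = scale e a" by simp
    then show "fract_eval scale f s a" unfolding fract_eval_def using e by blast
  next
    assume "fract_eval scale f s a"
    then obtain e g where e: "e \<noteq> 0" "smult (to_fract e) f = fract_poly g" "alg_eval scale g s = scale e a"
      unfolding fract_eval_def by blast
    obtain d where d: "d \<noteq> 0" "\<And>k. k \<noteq> 0 \<Longrightarrow>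
      w - frag_of (clear scale (d * k) w, inverse (to_fract (d * k))) \<in> tensor_kernel scale fract_scale"
      using tensor_single_denominator[of w] by blast
    have "clear scale (d * e) w = 0" using clear_w[OF e(2,1), of d] e(3) by (simp add: mult.commute)
    then have "w - frag_of (0, inverse (to_fract (d * e))) \<in> tensor_kernel scale fract_scale"
      using d(2)[OF e(1)] by simp
    from tensor_kernel_add[OF alg unital_algebra_fract_scale this
        frag_of_0_in_kernel[of "inverse (to_fract (d * e))"]]
    show "w \<in> tensor_kernel scale fract_scale" by simp
  qed
qed

end

section \<open>The integral closure of the ring of integer-valued polynomials\<close>

theorem mainTheorem4:
  fixes scale :: "'d::idom \<Rightarrow> 'a::ring_1 \<Rightarrow> 'a"
    and S :: "'a set"
  assumes "integrally_closed_domain TYPE('d)"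
    and "\<not> (\<forall>d::'d. d \<noteq> 0 \<longrightarrow> d dvd 1)"
    and "unital_algebra scale"
    and "torsion_free_module scale"
    and "finitely_generated_module scale"
    and "finite S"
    and "S \<noteq> {}"
  shows "prufer_domain (integral_closure (to_fract ` Int_K scale S :: 'd fract poly fract set))
     \<longleftrightarrow> prufer_domain (range (to_fract :: 'd \<Rightarrow> 'd fract))"
proof -
  note alg = assms(3)
  have Int: "f \<in> Int_K scale S \<longleftrightarrow> (\<forall>s\<in>S. \<exists>a. fract_eval scale f s a)" for f
    unfolding Int_K_def by (auto simp: eval_extended_eq_embed_iff[OF alg assms(4)] image_iff)
  obtain \<mu> where \<mu>: "\<mu> \<noteq> 0" "\<not> \<mu> dvd 1" "\<And>f. (\<forall>s\<in>S. fract_eval scale f s 0) \<longleftrightarrow> \<mu> dvd f"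
    by (rule vanishing_polynomial[OF alg assms(4-7)]) (rule that)
  define Z where "Z = {\<alpha>. ac_eval \<mu> \<alpha> = 0}"
  have deg: "degree (map_poly to_ac \<mu>) = degree \<mu>" using \<mu>(1) by (intro map_poly_degree_eq) simp
  have "degree \<mu> \<noteq> 0"
  proof
    assume "degree \<mu> = 0"
    then obtain c where "\<mu> = [:c:]" by (rule degree_eq_zeroE)
    then show False using \<mu>(1,2) by (simp add: is_unit_const_poly_iff)
  qed
  then have "map_poly to_ac \<mu> \<noteq> 0" using deg by auto
  then have "finite Z" unfolding Z_def ac_eval_def by (rule poly_roots_finite)
  have "Z \<noteq> {}"
    using alg_closed_imp_poly_has_root[of "map_poly to_ac \<mu>"] deg \<open>degree \<mu> \<noteq> 0\<close>
    by (auto simp: Z_def ac_eval_def)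
  have "integral_closure (to_fract ` Int_K scale S) = to_fract ` integral_on Z"
    unfolding Z_def
  proof (rule integral_closure_eq_integral_on[OF \<mu>(1)])
    show "Int_K scale S \<subseteq> integral_on {\<alpha>. ac_eval \<mu> \<alpha> = 0}"
      using int_valued_roots_integral[OF alg assms(5,6) \<mu>(3)] by (auto simp: Int integral_on_def)
    show "[:to_fract d:] + \<mu> * h \<in> Int_K scale S" for d h
      unfolding Int
    proof
      fix s assume "s \<in> S"
      then have "fract_eval scale (\<mu> * h) s 0" using \<mu>(3)[of "\<mu> * h"] by simp
      then show "\<exists>a. fract_eval scale ([:to_fract d:] + \<mu> * h) s a"
        using fract_eval_add[OF alg fract_eval_const[OF alg]] by blast
    qed
  qed
  then show ?thesis
    using prufer_integral_on[OF _ \<open>finite Z\<close>] prufer_base_domain[OF assms(1) \<open>Z \<noteq> {}\<close>] by metis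
qed

end
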